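(* Let $(Y_t)_{t\ge 0}$ be a driftless subordinator with $Y_0=0$ and $Y_t\in(0,\infty)$ for $t>0$, with Laplace exponent $\Phi(u)=\int_0^\infty(1-\mathrm{e}^{-ux})\,\mathrm{d}\nu(x)$, Lévy measure $\nu$, tail $\overline{\nu}(x)=\int_x^\infty\mathrm{d}\nu(u)$ for $x>0$, and let $F(x)=\mathbb{P}(Y_1\le x)$. Let $Y^\ast$ be a positive random variable which is not concentrated at one point, and let $F^\ast(x)=\mathbb{P}(Y^\ast\le x)$ be its distribution function. Then the following statements are equivalent: (S1) $Y_t^{-t}\to Y^\ast$ in distribution as $t\to 0$; (S2) $t\,\Phi(u^{1/t})\to-\log(1-F^\ast(u))$ as $t\to 0$, for all continuity points $u>0$ of $F^\ast$; (S3) $Y_t^{-t}\to\mathcal{P}_\gamma$ in distribution as $t\to0$ for some $\gamma>0$. Furthermore, for any $\gamma>0$ the following statements are equivalent: (S4) $Y_t^{-t}\to\mathcal{P}_\gamma$ in distribution as $t\to 0$; (S5) $\Phi(s)/\log s\to\gamma$ as $s\to\infty$; (S6) $\log F(x)/\log x\to\gamma$ as $x\to 0$; (S7) $\overline{\nu}(x)/\log x\to-\gamma$ as $x\to 0$. If $F$ is absolutely continuous near the origin, that is, if there is a measurable function $f$ such that $F(x)=\int_0^x f(u)\,\mathrm{d}u$ for all $x\ge0$ in a neighborhood of the origin, then (S8) $\log f(x)/\log x\to\gamma-1$ as $x\to0$ implies (S4)–(S7). If additionally the density $f$ is monotone near the origin, then (S8) is equivalent to (S4)–(S7).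
   Context: A subordinator is an increasing Lévy process $(Y_t)_{t\ge0}$ with $Y_0=0$. That it is driftless with Laplace exponent $\Phi$ means $\mathbb{E}(\mathrm{e}^{-uY_t})=\mathrm{e}^{-t\Phi(u)}$ with $\Phi(u)=\int_0^\infty(1-\mathrm{e}^{-ux})\,\mathrm{d}\nu(x)$, where the Lévy measure $\nu$, supported in $[0,\infty)$, satisfies $\int_x^\infty\mathrm{d}\nu(u)<\infty$ and $\int_0^x u\,\mathrm{d}\nu(u)<\infty$ for all $x>0$. For $\gamma>0$, $\mathcal{P}_\gamma$ denotes the Pareto law with distribution function $\Pi_\gamma(x)=(1-x^{-\gamma})\mathbf{1}_{[1,\infty)}(x)$. $Y_t^{-t}$ denotes $(Y_t)^{-t}$. Limits $x\to0$ and $t\to0$ are from the right, and $-\log 0=\infty$.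
   Formalization: For fixed Y*, (S3) does not mention Y* and cannot imply (S1) unless Y* is Pareto; so (S3) is read with "and Y* has law P_γ" added, and the equivalence is also given with "for some Y*" put in (S1) and (S2) and (S3) as written. *)

theory Defs
  imports "HOL-Probability.Probability"
begin

section \<open>Convergence in distribution along a filter\<close>

text \<open>
  The library's \<open>weak_conv_m\<close> only covers sequences; here the index tends to \<open>0\<close> from the right.
\<close>

definition weak_conv_filter :: "('i \<Rightarrow> real measure) \<Rightarrow> real measure \<Rightarrow> 'i filter \<Rightarrow> bool" where
  "weak_conv_filter \<mu> \<mu>' G \<longleftrightarrow>
     (\<forall>x. isCont (cdf \<mu>') x \<longrightarrow> ((\<lambda>i. cdf (\<mu> i) x) \<longlongrightarrow> cdf \<mu>' x) G)"

lemma weak_conv_filter_sequentially: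
  "weak_conv_filter \<mu> \<mu>' sequentially \<longleftrightarrow> weak_conv_m \<mu> \<mu>'"
  by (simp add: weak_conv_filter_def weak_conv_m_def weak_conv_def)

section \<open>Levy processes and subordinators\<close>

locale levy_process = prob_space M for M :: "'a measure" +
  fixes Y :: "real \<Rightarrow> 'a \<Rightarrow> real"
  assumes random_variable_Y: "\<And>t. t \<ge> 0 \<Longrightarrow> random_variable borel (Y t)"
    and start_zero: "AE \<omega> in M. Y 0 \<omega> = 0"
    and independent_increments:
      "\<And>(n::nat) \<tau>. 0 \<le> \<tau> 0 \<Longrightarrow> mono_on {..n} \<tau> \<Longrightarrow>
         indep_vars (\<lambda>_. borel) (\<lambda>k \<omega>. Y (\<tau> (Suc k)) \<omega> - Y (\<tau> k) \<omega>) {..<n}"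
    and stationary_increments:
      "\<And>s t. s \<ge> 0 \<Longrightarrow> t \<ge> 0 \<Longrightarrow>
         distr M borel (\<lambda>\<omega>. Y (s + t) \<omega> - Y s \<omega>) = distr M borel (Y t)"
    and cadlag_paths:
      "AE \<omega> in M. (\<forall>t\<ge>0. continuous (at_right t) (\<lambda>s. Y s \<omega>)) \<and>
                  (\<forall>t>0. \<exists>l. ((\<lambda>s. Y s \<omega>) \<longlongrightarrow> l) (at_left t))"

locale subordinator = levy_process +
  assumes increasing_paths: "AE \<omega> in M. mono_on {0..} (\<lambda>t. Y t \<omega>)"

text \<open>
  Mass of \<open>\<nu>\<close> at the point \<open>0\<close> is not excluded; it enters neither the Laplace exponent nor the tail.
\<close>

definition subordinator_levy_measure :: "real measure \<Rightarrow> bool" where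
  "subordinator_levy_measure \<nu> \<longleftrightarrow>
     sets \<nu> = sets borel \<and> emeasure \<nu> {..<0} = 0 \<and>
     (\<forall>x>0. emeasure \<nu> {x<..} < \<infinity> \<and> (\<integral>\<^sup>+u\<in>{0<..x}. ennreal u \<partial>\<nu>) < \<infinity>)"

definition laplace_exponent :: "real measure \<Rightarrow> real \<Rightarrow> real" where
  "laplace_exponent \<nu> u = (LINT x:{0<..}|\<nu>. 1 - exp (- u * x))"

definition levy_tail :: "real measure \<Rightarrow> real \<Rightarrow> real" where
  "levy_tail \<nu> x = measure \<nu> {x<..}"

locale driftless_subordinator = subordinator +
  fixes \<nu> :: "real measure"
  assumes levy_measure: "subordinator_levy_measure \<nu>"
    and laplace_transform: "\<And>t u. t \<ge> 0 \<Longrightarrow> u \<ge> 0 \<Longrightarrow>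
      expectation (\<lambda>\<omega>. exp (- u * Y t \<omega>)) = exp (- t * laplace_exponent \<nu> u)"

section \<open>The limit laws\<close>

definition power_law :: "'a measure \<Rightarrow> (real \<Rightarrow> 'a \<Rightarrow> real) \<Rightarrow> real \<Rightarrow> real measure" where
  "power_law M Y t = distr M borel (\<lambda>\<omega>. Y t \<omega> powr (- t))"

definition pareto_cdf :: "real \<Rightarrow> real \<Rightarrow> real" where
  "pareto_cdf \<gamma> x = (if 1 \<le> x then 1 - x powr (- \<gamma>) else 0)"

definition pareto :: "real \<Rightarrow> real measure" where
  "pareto \<gamma> = interval_measure (pareto_cdf \<gamma>)"

lemma
  assumes "\<gamma> > 0"
  shows cdf_pareto: "cdf (pareto \<gamma>) = pareto_cdf \<gamma>"
    and real_distribution_pareto: "real_distribution (pareto \<gamma>)"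
proof -
  have eq: "pareto_cdf \<gamma> x = 1 - max 1 x powr (- \<gamma>)" for x
    by (auto simp: pareto_cdf_def max_def)
  have mono: "pareto_cdf \<gamma> x \<le> pareto_cdf \<gamma> y" if "x \<le> y" for x y
    unfolding eq using that assms by (auto intro!: powr_mono2')
  have cont: "isCont (pareto_cdf \<gamma>) a" for a
    unfolding eq[abs_def] by (auto intro!: continuous_intros)
  then have right: "continuous (at_right a) (pareto_cdf \<gamma>)" for a
    by (simp add: continuous_at_imp_continuous_at_within)
  have bot: "(pareto_cdf \<gamma> \<longlongrightarrow> 0) at_bot"
    by (rule tendsto_eventually)
       (auto simp: pareto_cdf_def eventually_at_bot_linorder intro!: exI[of _ 0])
  have "((\<lambda>x. 1 - x powr (- \<gamma>)) \<longlongrightarrow> 1 - 0) at_top"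
    using assms by (intro tendsto_intros tendsto_neg_powr filterlim_ident) auto
  moreover have "eventually (\<lambda>x. 1 - x powr (- \<gamma>) = pareto_cdf \<gamma> x) at_top"
    using eventually_ge_at_top[of 1] by eventually_elim (simp add: pareto_cdf_def)
  ultimately have top: "(pareto_cdf \<gamma> \<longlongrightarrow> 1) at_top"
    by (simp add: tendsto_cong)
  show "cdf (pareto \<gamma>) = pareto_cdf \<gamma>"
    unfolding pareto_def using mono right bot by (rule cdf_interval_measure)
  show "real_distribution (pareto \<gamma>)"
    unfolding pareto_def using mono right bot top by (rule real_distribution_interval_measure)
qed

definition nondegenerate_positive_rv :: "'b measure \<Rightarrow> ('b \<Rightarrow> real) \<Rightarrow> bool" where
  "nondegenerate_positive_rv N Z \<longleftrightarrow>
     prob_space N \<and> Z \<in> borel_measurable N \<and> (AE \<omega> in N. 0 < Z \<omega>) \<and>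
     \<not> (\<exists>c. AE \<omega> in N. Z \<omega> = c)"

text \<open>The function \<open>- log\<close> on \<open>[0, \<infinity>)\<close> with the convention \<open>- log 0 = \<infinity>\<close>.\<close>

definition neg_log :: "real \<Rightarrow> ereal" where
  "neg_log p = (if p = 0 then \<infinity> else ereal (- ln p))"

definition scaled_exponent_converges :: "real measure \<Rightarrow> (real \<Rightarrow> real) \<Rightarrow> bool" where
  "scaled_exponent_converges \<nu> H \<longleftrightarrow>
     (\<forall>u>0. isCont H u \<longrightarrow>
        ((\<lambda>t. ereal (t * laplace_exponent \<nu> (u powr (1 / t)))) \<longlongrightarrow> neg_log (1 - H u)) (at_right 0))"

section \<open>Behaviour of a distribution function near the origin\<close>

definition density_near_origin :: "(real \<Rightarrow> real) \<Rightarrow> (real \<Rightarrow> real) \<Rightarrow> bool" where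
  "density_near_origin F f \<longleftrightarrow>
     f \<in> borel_measurable lebesgue \<and>
     (\<exists>\<delta>>0. \<forall>x. 0 \<le> x \<and> x < \<delta> \<longrightarrow>
        set_integrable lebesgue {0..x} f \<and> F x = (LINT u:{0..x}|lebesgue. f u))"

definition monotone_near_origin :: "(real \<Rightarrow> real) \<Rightarrow> bool" where
  "monotone_near_origin f \<longleftrightarrow>
     (\<exists>\<delta>>0. mono_on {0<..<\<delta>} f \<or> antimono_on {0<..<\<delta>} f)"

text \<open>
  Positivity of \<open>f\<close> near \<open>0\<close> is part of the meaning of \<open>log f(x) / log x \<longrightarrow> a\<close> for finite \<open>a\<close>:
  the logarithm of a negative number is undefined and \<open>log 0 = - \<infinity>\<close>, whereas the library
  has \<open>ln 0 = 0\<close>.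
\<close>

definition log_ratio_at_origin :: "(real \<Rightarrow> real) \<Rightarrow> real \<Rightarrow> bool" where
  "log_ratio_at_origin f a \<longleftrightarrow>
     (\<forall>\<^sub>F x in at_right 0. 0 < f x) \<and> ((\<lambda>x. ln (f x) / ln x) \<longlongrightarrow> a) (at_right 0)"

end

theory Submission
  imports Defs "HOL-Real_Asymp.Real_Asymp"
begin

text \<open>
  Every equivalence is a comparison of exponents on the logarithmic scale, where crude two-sided
  bounds are sharp. With \<open>z = u powr (1 / t)\<close> the Laplace transform of \<open>Y t\<close> at \<open>z\<close> is squeezed
  between tails of \<open>Y t powr (- t)\<close> at points close to \<open>u\<close>, which gives S1 and S2; as \<open>t\<close> varies
  with \<open>u > 1\<close> fixed, \<open>z\<close> runs through all large numbers and \<open>t = ln u / ln z\<close>, so a finite limit at a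
  single \<open>u > 1\<close> already forces \<open>\<Phi> s / ln s\<close> to converge and the limit law to be Pareto.
  The passages from \<open>\<Phi>\<close> to \<open>F\<close> and to the tail of \<open>\<nu>\<close> use
  \<open>F x * exp (- s * x) \<le> exp (- \<Phi> s) \<le> F x + exp (- s * x)\<close> and
  \<open>(1 - exp (- s * x)) * \<nu> {x<..} \<le> \<Phi> s \<le> \<nu> {x<..} + 2 * s * x * \<Phi> (1 / x)\<close>, with \<open>s * x\<close> a power
  of \<open>ln x\<close>.
\<close>

text \<open>Near the origin \<open>F\<close> is known only through \<open>ln (F x) / ln x\<close>,
  which leaves room for arbitrary powers of \<open>ln x\<close> as factors. The compensation is
  freedom in coupling \<open>s\<close> and \<open>x\<close>: if \<open>s * x\<close> diverges or
  vanishes like a power of the logarithm, \<open>ln s / ln x\<close> still tends to -1, and the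
  error term becomes negligible. The passage from the tail of \<nu> to \<Phi> is the exception. The
  upper bound by \<open>\<nu> {x<..}\<close> contains \<Phi> at \<open>1 / x\<close>, an argument
  beyond \<open>s\<close> once \<open>s * x < 1\<close>, so it is circular as long as the growth of
  \<Phi> is unknown. There the integral is broken into dyadic layers, and only values of the tail
  remain. In the identification of the limit law the exponents 0 and infinity are the boundary
  cases. If \<Phi> grows faster than the logarithm, the limit is the point mass at 1; if it grows
  more slowly, all mass escapes to infinity. The first is removed because the limit is not
  concentrated at one point, the second because the limit has total mass one.\<close>

section \<open>Bounds between the Laplace exponent and the tail of the Levy measure\<close>

lemma levy_measurable:
  assumes "subordinator_levy_measure \<nu>"
  shows "sets \<nu> = sets borel"
  using assms by (simp add: subordinator_levy_measure_def)

lemma emeasure_levy_tail: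
  assumes "subordinator_levy_measure \<nu>" "x > 0"
  shows "emeasure \<nu> {x<..} = ennreal (levy_tail \<nu> x)"
  using assms unfolding subordinator_levy_measure_def levy_tail_def
  by (intro emeasure_eq_ennreal_measure) auto

text \<open>The integrand is at most \<open>s * x\<close> on \<open>{0<..1}\<close> and at most 1
  beyond; the two resulting integrals are the ones that a Levy measure keeps finite.\<close>

lemma laplace_exponent_integrable:
  assumes L: "subordinator_levy_measure \<nu>" and s: "s \<ge> 0"
  shows "set_integrable \<nu> {0<..} (\<lambda>x. 1 - exp (- s * x))"
proof -
  note [measurable_cong] = levy_measurable[OF L]
  have "(\<integral>\<^sup>+x. ennreal (norm (indicator {0<..} x *\<^sub>R (1 - exp (- s * x)))) \<partial>\<nu>)
      \<le> (\<integral>\<^sup>+x. ennreal s * (ennreal x * indicator {0<..1} x) + indicator {1<..} x \<partial>\<nu>)"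
  proof (intro nn_integral_mono)
    fix x :: real
    consider "x \<le> 0" | "0 < x" "x \<le> 1" | "x > 1" by linarith
    then show "ennreal (norm (indicator {0<..} x *\<^sub>R (1 - exp (- s * x))))
        \<le> ennreal s * (ennreal x * indicator {0<..1} x) + indicator {1<..} x"
    proof cases
      case 2
      have "1 + - s * x \<le> exp (- s * x)" by (rule exp_ge_add_one_self)
      moreover have "exp (- s * x) \<le> 1" using s 2 by simp
      ultimately show ?thesis using 2 s by (auto simp: ennreal_mult'[symmetric] intro!: ennreal_leI)
    next
      case 3
      have "exp (- s * x) \<le> 1" using s 3 by simp
      then show ?thesis using 3 s by auto
    qed auto
  qed
  also have "\<dots> = ennreal s * (\<integral>\<^sup>+x\<in>{0<..1}. ennreal x \<partial>\<nu>) + emeasure \<nu> {1<..}"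
    by (subst nn_integral_add) (auto simp: nn_integral_cmult)
  also have "\<dots> < \<infinity>"
    using L unfolding subordinator_levy_measure_def
    by (auto simp: ennreal_mult_less_top dest!: spec[of _ "1::real"])
  finally show ?thesis
    unfolding set_integrable_def by (intro integrableI_bounded) auto
qed

text \<open>Only the jumps larger than \<open>x\<close> are kept, and on them the increasing
  integrand is at least its value at \<open>x\<close>.\<close>

lemma laplace_exponent_ge:
  assumes L: "subordinator_levy_measure \<nu>" and s: "s \<ge> 0" and x: "x > 0"
  shows "(1 - exp (- s * x)) * levy_tail \<nu> x \<le> laplace_exponent \<nu> s"
proof -
  note [measurable_cong] = levy_measurable[OF L]
  have fin: "emeasure \<nu> {x<..} < \<infinity>"
    using L x by (simp add: subordinator_levy_measure_def)
  have "(1 - exp (- s * x)) * levy_tail \<nu> x = (LINT u|\<nu>. (1 - exp (- s * x)) * indicator {x<..} u)"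
    by (simp add: levy_tail_def levy_measurable[OF L] sets_eq_imp_space_eq[OF levy_measurable[OF L]])
  also have "\<dots> \<le> (LINT u|\<nu>. indicator {0<..} u *\<^sub>R (1 - exp (- s * u)))"
  proof (rule integral_mono)
    show "integrable \<nu> (\<lambda>u. (1 - exp (- s * x)) * indicator {x<..} u)"
      using fin by (intro integrable_mult_right integrable_real_indicator) (auto simp: levy_measurable[OF L])
    show "integrable \<nu> (\<lambda>u. indicator {0<..} u *\<^sub>R (1 - exp (- s * u)))"
      using laplace_exponent_integrable[OF L s] by (simp add: set_integrable_def)
  qed (use s x in \<open>auto simp: indicator_def mult_left_mono\<close>)
  finally show ?thesis by (simp add: laplace_exponent_def set_lebesgue_integral_def)
qed

lemma laplace_exponent_mono:
  assumes L: "subordinator_levy_measure \<nu>" and "0 \<le> s" "s \<le> r"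
  shows "laplace_exponent \<nu> s \<le> laplace_exponent \<nu> r"
  unfolding laplace_exponent_def
  by (intro set_integral_mono laplace_exponent_integrable[OF L]) (use assms in \<open>auto simp: mult_right_mono\<close>)

lemma laplace_exponent_nonneg:
  assumes "s \<ge> 0"
  shows "laplace_exponent \<nu> s \<ge> 0"
  unfolding laplace_exponent_def set_lebesgue_integral_def
  using assms by (intro integral_nonneg_AE) (auto simp: indicator_def)

text \<open>This trades a linear function for the integrand of a Laplace exponent; the factor 1/2 is
  the source of the constant 2 in \<open>laplace_exponent_le_tail\<close>. It follows from
  \<open>exp y \<ge> 1 + y\<close> and \<open>(1 + y) * (1 - y / 2) \<ge> 1\<close> on the unit
  interval.\<close>

lemma one_minus_exp_minus_ge_half:
  fixes y :: real
  assumes "0 \<le> y" "y \<le> 1"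
  shows "y / 2 \<le> 1 - exp (- y)"
proof -
  have "(1 + y) * (1 - y / 2) \<ge> 1"
    using assms mult_left_le[of y y] by (simp add: algebra_simps)
  moreover have "exp y \<ge> 1 + y" by (rule exp_ge_add_one_self)
  moreover have "1 - y / 2 \<ge> 0" using assms by simp
  ultimately have "exp y * (1 - y / 2) \<ge> 1" by (meson mult_right_mono order_trans)
  then show ?thesis by (simp add: exp_minus field_simps)
qed

text \<open>A jump above \<open>x\<close> contributes at most 1. For \<open>u \<le> x\<close> the
  integrand is at most \<open>s * u = s * x * (u / x)\<close>, and \<open>u / x\<close> is at most
  twice the integrand at parameter \<open>1 / x\<close>. The small jumps are thus controlled by the
  exponent itself, without integrating the tail.\<close>

lemma laplace_exponent_le_tail:
  assumes L: "subordinator_levy_measure \<nu>" and s: "s \<ge> 0" and x: "x > 0"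
  shows "laplace_exponent \<nu> s \<le> levy_tail \<nu> x + 2 * s * x * laplace_exponent \<nu> (1 / x)"
proof -
  note [measurable_cong] = levy_measurable[OF L]
  have fin: "emeasure \<nu> {x<..} < \<infinity>"
    using L x by (simp add: subordinator_levy_measure_def)
  have i1: "integrable \<nu> (\<lambda>u. indicator {x<..} u :: real)"
    using fin by (intro integrable_real_indicator) (auto simp: levy_measurable[OF L])
  have i2: "integrable \<nu> (\<lambda>u. indicator {0<..} u *\<^sub>R (1 - exp (- t * u)))" if "t \<ge> 0" for t :: real
    using laplace_exponent_integrable[OF L that] by (simp add: set_integrable_def)
  have i3: "integrable \<nu> (\<lambda>u. 2 * s * x * (indicator {0<..} u *\<^sub>R (1 - exp (- (1 / x) * u))))"
    using x by (intro integrable_mult_right i2) auto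
  have "laplace_exponent \<nu> s = (LINT u|\<nu>. indicator {0<..} u *\<^sub>R (1 - exp (- s * u)))"
    by (simp add: laplace_exponent_def set_lebesgue_integral_def)
  also have "\<dots> \<le> (LINT u|\<nu>. indicator {x<..} u + 2 * s * x * (indicator {0<..} u *\<^sub>R (1 - exp (- (1 / x) * u))))"
  proof (rule integral_mono[OF i2[OF s]])
    show "integrable \<nu> (\<lambda>u. indicator {x<..} u + 2 * s * x * (indicator {0<..} u *\<^sub>R (1 - exp (- (1 / x) * u))))"
      by (intro Bochner_Integration.integrable_add i1 i3)
    fix u :: real
    consider "u \<le> 0" | "0 < u" "u \<le> x" | "u > x" by linarith
    then show "indicator {0<..} u *\<^sub>R (1 - exp (- s * u))
        \<le> indicator {x<..} u + 2 * s * x * (indicator {0<..} u *\<^sub>R (1 - exp (- (1 / x) * u)))"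
    proof cases
      case 2
      have "1 + - s * u \<le> exp (- s * u)" by (rule exp_ge_add_one_self)
      moreover have "2 * s * x * ((u / x) / 2) \<le> 2 * s * x * (1 - exp (- (u / x)))"
        using 2 x s by (intro mult_left_mono one_minus_exp_minus_ge_half) auto
      ultimately show ?thesis using 2 x by simp
    next
      case 3
      then have "0 \<le> 2 * s * x * (1 - exp (- (1 / x) * u))" using s x by auto
      then show ?thesis using 3 x by (simp add: add_increasing2)
    qed (use x in auto)
  qed
  also have "\<dots> = levy_tail \<nu> x + 2 * s * x * laplace_exponent \<nu> (1 / x)"
    unfolding Bochner_Integration.integral_add[OF i1 i3] integral_mult_right_zero
    by (simp add: levy_tail_def laplace_exponent_def set_lebesgue_integral_def
        sets_eq_imp_space_eq[OF levy_measurable[OF L]])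
  finally show ?thesis .
qed

text \<open>A discrete layer-cake formula: integrated against \<nu>, it bounds \<Phi> by a weighted
  sum of tails. For the least \<open>k\<close> with \<open>(1/2) ^ Suc k < y\<close>, all terms from
  index \<open>k\<close> on are present and sum to \<open>(1/2) ^ k\<close>; minimality of
  \<open>k\<close> gives \<open>y \<le> (1/2) ^ k\<close> when \<open>k > 0\<close>, and for
  \<open>k = 0\<close> the cap at 1 takes over.\<close>

lemma min_one_le_dyadic_sum:
  fixes y :: real
  assumes "y > 0"
  shows "ennreal (min 1 y) \<le> (\<Sum>j. ennreal ((1/2) ^ Suc j) * indicator {(1/2) ^ Suc j<..} y)"
proof -
  have ex: "\<exists>k. (1/2) ^ Suc k < y"
  proof -
    obtain n where "(1/2) ^ n < y" using real_arch_pow_inv[of y "1/2"] assms by auto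
    moreover have "(1/2 :: real) ^ Suc n \<le> (1/2) ^ n" by (intro power_decreasing) auto
    ultimately show ?thesis by (intro exI[of _ n]) linarith
  qed
  define k where "k = (LEAST k. (1/2) ^ Suc k < y)"
  have k: "(1/2) ^ Suc k < y"
    unfolding k_def using ex by (rule LeastI_ex)
  have le: "min 1 y \<le> (1/2) ^ k"
  proof (cases k)
    case (Suc m)
    then have "\<not> (1/2) ^ Suc m < y" using not_less_Least[of m "\<lambda>k. (1/2) ^ Suc k < y"] by (simp add: k_def)
    then show ?thesis using Suc by auto
  qed simp
  have "(\<lambda>j. (1/2) ^ k * (1/2) ^ Suc j) sums ((1/2) ^ k * (1::real))"
    using power_half_series by (rule sums_mult)
  then have "(\<lambda>j. ennreal ((1/2) ^ Suc (j + k))) sums ennreal ((1/2) ^ k)"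
    by (subst sums_ennreal) (auto simp: power_add mult_ac)
  then have "ennreal ((1/2) ^ k) = (\<Sum>j. ennreal ((1/2) ^ Suc (j + k)))"
    by (simp add: sums_iff)
  also have "\<dots> = (\<Sum>j. ennreal ((1/2) ^ Suc (j + k)) * indicator {(1/2) ^ Suc (j + k)<..} y)"
  proof (intro arg_cong[where f = suminf] ext)
    fix j
    have "(1/2 :: real) ^ Suc (j + k) \<le> (1/2) ^ Suc k" by (intro power_decreasing) auto
    with k have "(1/2) ^ Suc (j + k) < y" by (rule le_less_trans[rotated])
    then show "ennreal ((1/2) ^ Suc (j + k)) = ennreal ((1/2) ^ Suc (j + k)) * indicator {(1/2) ^ Suc (j + k)<..} y"
      by (simp del: power_Suc)
  qed
  also have "\<dots> \<le> (\<Sum>j. ennreal ((1/2) ^ Suc j) * indicator {(1/2) ^ Suc j<..} y)"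
    (is "_ \<le> suminf ?f")
    using suminf_offset[of ?f k] by (simp add: add_increasing2)
  finally show ?thesis using le by (meson ennreal_leI order_trans)
qed

text \<open>The integrand is at most \<open>min 1 (s * u)\<close>, whose dyadic layers give the
  tails at \<open>(1/2) ^ Suc j / s\<close> with weights \<open>(1/2) ^ Suc j\<close>. A logarithmic
  tail grows only linearly in \<open>j\<close> along these points, so the geometric weights leave
  the leading term \<open>c * ln s\<close> and a bounded excess.\<close>

lemma laplace_exponent_le_log:
  assumes L: "subordinator_levy_measure \<nu>" and s: "s \<ge> 1" and c: "c \<ge> 0"
    and tail: "\<And>x. 0 < x \<Longrightarrow> x < 1 / s \<Longrightarrow> levy_tail \<nu> x \<le> c * (- ln x)"
  shows "laplace_exponent \<nu> s \<le> c * (ln s + 2 * ln 2)"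
proof -
  note [measurable_cong] = levy_measurable[OF L]
  have s0: "s > 0" using s by simp
  have eq: "indicator {(1/2) ^ Suc j<..} (s * u) = (indicator {(1/2) ^ Suc j / s<..} u :: ennreal)" for j u
    using s0 by (auto simp: indicator_def field_simps)
  have "ennreal (laplace_exponent \<nu> s) = (\<integral>\<^sup>+u. ennreal (indicator {0<..} u *\<^sub>R (1 - exp (- s * u))) \<partial>\<nu>)"
    unfolding laplace_exponent_def set_lebesgue_integral_def
    using laplace_exponent_integrable[OF L, of s] s0
    by (intro nn_integral_eq_integral[symmetric]) (auto simp: set_integrable_def indicator_def)
  also have "\<dots> \<le> (\<integral>\<^sup>+u. (\<Sum>j. ennreal ((1/2) ^ Suc j) * indicator {(1/2) ^ Suc j / s<..} u) \<partial>\<nu>)"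
  proof (intro nn_integral_mono)
    fix u :: real
    show "ennreal (indicator {0<..} u *\<^sub>R (1 - exp (- s * u)))
        \<le> (\<Sum>j. ennreal ((1/2) ^ Suc j) * indicator {(1/2) ^ Suc j / s<..} u)"
    proof (cases "u > 0")
      case True
      have "1 + - s * u \<le> exp (- s * u)" by (rule exp_ge_add_one_self)
      then have "1 - exp (- s * u) \<le> min 1 (s * u)" by simp
      then have "ennreal (1 - exp (- s * u)) \<le> ennreal (min 1 (s * u))" by (rule ennreal_leI)
      also have "\<dots> \<le> (\<Sum>j. ennreal ((1/2) ^ Suc j) * indicator {(1/2) ^ Suc j<..} (s * u))"
        using s0 True by (intro min_one_le_dyadic_sum) simp
      finally show ?thesis using True unfolding eq by simp
    qed simp
  qed
  also have "\<dots> = (\<Sum>j. \<integral>\<^sup>+u. ennreal ((1/2) ^ Suc j) * indicator {(1/2) ^ Suc j / s<..} u \<partial>\<nu>)"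
    by (intro nn_integral_suminf) auto
  also have "\<dots> = (\<Sum>j. ennreal ((1/2) ^ Suc j * levy_tail \<nu> ((1/2) ^ Suc j / s)))"
    using s0 by (intro arg_cong[where f = suminf] ext)
      (subst nn_integral_cmult_indicator,
        simp_all del: power_Suc add: emeasure_levy_tail[OF L] ennreal_mult' levy_measurable[OF L])
  also have "\<dots> \<le> (\<Sum>j. ennreal ((1/2) ^ Suc j * (c * (ln s + real (Suc j) * ln 2))))"
  proof (intro suminf_le ennreal_leI mult_left_mono)
    fix j :: nat
    \<comment> \<open>Layers starting at exponent 1 rather than 0 keep every dyadic point strictly
      below \<open>1 / s\<close>, the range covered by \<open>tail\<close>.\<close>
    have p: "(1/2 :: real) ^ Suc j < 1" by (intro power_Suc_less_one) auto
    then have "levy_tail \<nu> ((1/2) ^ Suc j / s) \<le> c * (- ln ((1/2) ^ Suc j / s))"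
      using s0 by (intro tail divide_strict_right_mono) (auto simp del: power_Suc)
    also have "ln ((1/2 :: real) ^ Suc j / s) = - (ln s + real (Suc j) * ln 2)"
      using s0 by (simp add: ln_div ln_realpow ln_mult algebra_simps)
    finally show "levy_tail \<nu> ((1/2) ^ Suc j / s) \<le> c * (ln s + real (Suc j) * ln 2)"
      by (simp del: of_nat_Suc power_Suc add: add.commute)
  qed auto
  also have "\<dots> = ennreal (c * (ln s + 2 * ln 2))"
  proof -
    \<comment> \<open>The weights \<open>(1/2) ^ Suc j\<close> sum to 1, and the mean of
      \<open>Suc j\<close> under them is 2; hence the constant \<open>2 * ln 2\<close>.\<close>
    have "(\<lambda>j. real (Suc j) * (1/2) ^ j) sums (1 / (1 - 1/2)\<^sup>2)"
      using geometric_deriv_sums[of "1/2 :: real"] by simp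
    then have "(\<lambda>j. c * ln s * (1/2) ^ Suc j + c * ln 2 * (1/2) * (real (Suc j) * (1/2) ^ j))
        sums (c * ln s * 1 + c * ln 2 * (1/2) * (1 / (1 - 1/2)\<^sup>2))"
      by (intro sums_add sums_mult power_half_series)
    then have *: "(\<lambda>j. (1/2) ^ Suc j * (c * (ln s + real (Suc j) * ln 2))) sums (c * (ln s + 2 * ln 2))"
      by (simp add: algebra_simps power2_eq_square)
    show ?thesis
      using * c s by (intro suminf_ennreal_eq) auto
  qed
  finally show ?thesis using c s by (subst (asm) ennreal_le_iff) auto
qed

section \<open>Laplace transforms and distribution functions near the origin\<close>

context prob_space
begin

lemma exp_minus_integrable:
  fixes X :: "'a \<Rightarrow> real"
  assumes "random_variable borel X" "AE \<omega> in M. 0 < X \<omega>" "s \<ge> 0"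
  shows "integrable M (\<lambda>\<omega>. exp (- s * X \<omega>))"
  using assms by (intro integrable_const_bound[of _ 1]) (auto elim!: eventually_mono)

text \<open>Chernoff's bound, from restricting the expectation to the event. This bound and the next
  one use different events, weak and strict inequality, each the one that makes its bound
  stronger.\<close>

lemma laplace_ge_prob_le:
  fixes X :: "'a \<Rightarrow> real"
  assumes X: "random_variable borel X" "AE \<omega> in M. 0 < X \<omega>" and s: "s \<ge> 0"
  shows "prob {\<omega> \<in> space M. X \<omega> \<le> x} * exp (- s * x) \<le> expectation (\<lambda>\<omega>. exp (- s * X \<omega>))"
proof -
  note [measurable] = X(1)
  have "prob {\<omega> \<in> space M. X \<omega> \<le> x} * exp (- s * x)
      = expectation (\<lambda>\<omega>. indicator {\<omega> \<in> space M. X \<omega> \<le> x} \<omega> * exp (- s * x))"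
    by simp
  also have "\<dots> \<le> expectation (\<lambda>\<omega>. exp (- s * X \<omega>))"
    using s by (intro integral_mono exp_minus_integrable X integrable_mult_left integrable_real_indicator)
      (auto simp: indicator_def mult_left_mono less_top[symmetric])
  finally show ?thesis .
qed

text \<open>The expectation is split at \<open>x\<close>: the integrand is at most 1 below it and at
  most \<open>exp (- s * x)\<close> from it on. The strict event matters in
  \<open>power_law_sandwich\<close>, where it is exactly an upper tail of the decreasing transform
  \<open>Y t powr (- t)\<close>.\<close>

lemma laplace_le_prob_less:
  fixes X :: "'a \<Rightarrow> real"
  assumes X: "random_variable borel X" "AE \<omega> in M. 0 < X \<omega>" and s: "s \<ge> 0"
  shows "expectation (\<lambda>\<omega>. exp (- s * X \<omega>)) \<le> prob {\<omega> \<in> space M. X \<omega> < x} + exp (- s * x)"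
proof -
  note [measurable] = X(1)
  have i: "integrable M (\<lambda>\<omega>. indicator {\<omega> \<in> space M. X \<omega> < x} \<omega> :: real)"
    by (intro integrable_real_indicator) (auto simp: less_top[symmetric])
  have "expectation (\<lambda>\<omega>. exp (- s * X \<omega>))
      \<le> expectation (\<lambda>\<omega>. indicator {\<omega> \<in> space M. X \<omega> < x} \<omega> + exp (- s * x))"
  proof (rule integral_mono_AE[OF exp_minus_integrable[OF X s]])
    show "integrable M (\<lambda>\<omega>. indicator {\<omega> \<in> space M. X \<omega> < x} \<omega> + exp (- s * x))"
      using i by simp
    show "AE \<omega> in M. exp (- s * X \<omega>) \<le> indicator {\<omega> \<in> space M. X \<omega> < x} \<omega> + exp (- s * x)"
      using X(2) AE_space
    proof eventually_elim
      case (elim \<omega>)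
      show ?case
      proof (cases "X \<omega> < x")
        case True
        have "exp (- s * X \<omega>) \<le> 1" using elim s by simp
        moreover have "0 \<le> exp (- s * x)" by simp
        ultimately show ?thesis using True elim by (simp add: add_increasing2)
      qed (use s in \<open>auto simp: mult_left_mono\<close>)
    qed
  qed
  also have "\<dots> = prob {\<omega> \<in> space M. X \<omega> < x} + exp (- s * x)"
    using i by (simp add: prob_space)
  finally show ?thesis .
qed

lemma prob_less_le_prob_le:
  fixes X :: "'a \<Rightarrow> real"
  assumes [measurable]: "random_variable borel X"
  shows "prob {\<omega> \<in> space M. X \<omega> < x} \<le> prob {\<omega> \<in> space M. X \<omega> \<le> x}"
  by (intro finite_measure_mono) auto

end

text \<open>The choice \<open>s x = (log x)\<^sup>2\<close> makes \<open>exp (- s x)\<close> negligible against every power of \<open>x\<close>,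
  while \<open>log s \<sim> - log x\<close>.\<close>

lemma exponent_log_growth_iff_log_ratio:
  fixes F \<Phi> :: "real \<Rightarrow> real"
  assumes lower: "\<And>s x. s > 0 \<Longrightarrow> x > 0 \<Longrightarrow> F x * exp (- s * x) \<le> exp (- \<Phi> s)"
    and upper: "\<And>s x. s > 0 \<Longrightarrow> x > 0 \<Longrightarrow> exp (- \<Phi> s) \<le> F x + exp (- s * x)"
  shows "((\<lambda>s. \<Phi> s / ln s) \<longlongrightarrow> \<gamma>) at_top \<longleftrightarrow> log_ratio_at_origin F \<gamma>"
proof
  \<comment> \<open>For this side \<open>s * x = 1\<close> is enough: the factor
    \<open>exp (- 1)\<close> costs the additive constant 1, which vanishes after division by
    \<open>ln x\<close>.\<close>
  have ln_F_le: "ln (F x) \<le> 1 - \<Phi> (1 / x)" if "x > 0" "F x > 0" for x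
  proof -
    have "ln (F x * exp (- (1/x) * x)) \<le> ln (exp (- \<Phi> (1/x)))"
      using lower[of "1/x" x] that by (subst ln_le_cancel_iff) auto
    then show ?thesis using that by (simp add: ln_mult)
  qed
  {
    assume lim: "((\<lambda>s. \<Phi> s / ln s) \<longlongrightarrow> \<gamma>) at_top"
    define s where "s = (\<lambda>x::real. (ln x)\<^sup>2 / x)"
    have s_top: "filterlim s at_top (at_right 0)" unfolding s_def by real_asymp
    have "((\<lambda>x. \<Phi> (s x) / ln (s x) * (ln (s x) / ln x)) \<longlongrightarrow> \<gamma> * - 1) (at_right 0)"
    proof (intro tendsto_mult filterlim_compose[OF lim s_top])
      show "((\<lambda>x. ln (s x) / ln x) \<longlongrightarrow> - 1) (at_right 0)" unfolding s_def by real_asymp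
    qed
    moreover have s_gt: "eventually (\<lambda>x. s x > 1) (at_right 0)"
      using s_top by (simp add: filterlim_at_top_dense)
    then have "eventually (\<lambda>x. \<Phi> (s x) / ln (s x) * (ln (s x) / ln x) = \<Phi> (s x) / ln x) (at_right 0)"
      by eventually_elim auto
    ultimately have "((\<lambda>x. \<Phi> (s x) / ln x) \<longlongrightarrow> \<gamma> * - 1) (at_right 0)"
      by (rule Lim_transform_eventually)
    then have \<Phi>s: "((\<lambda>x. \<Phi> (s x) / ln x) \<longlongrightarrow> - \<gamma>) (at_right 0)" by simp
    have ln_neg: "eventually (\<lambda>x::real. ln x < - 1) (at_right 0)" by real_asymp
    have x01: "eventually (\<lambda>x::real. 0 < x \<and> x < 1) (at_right 0)"
      by (auto simp: eventually_at_right_field intro!: exI[of _ 1])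
    have "((\<lambda>x. \<Phi> (s x) / ln x * (1 / ln x) + ln 2 / (ln x)\<^sup>2) \<longlongrightarrow> - \<gamma> * 0 + 0) (at_right 0)"
      by (intro tendsto_add tendsto_mult \<Phi>s; real_asymp)
    then have "eventually (\<lambda>x. \<Phi> (s x) / ln x * (1 / ln x) + ln 2 / (ln x)\<^sup>2 < 1) (at_right 0)"
      by (intro order_tendstoD) auto
    \<comment> \<open>\<Phi> at \<open>s x\<close> is of order \<open>ln x\<close>, hence small
      against \<open>(ln x)\<^sup>2\<close>. The extra \<open>ln 2\<close> makes the error
      \<open>exp (- (ln x)\<^sup>2)\<close> at most half of \<open>exp (- \<Phi> (s x))\<close>, so
      \<open>upper\<close> leaves the other half to \<open>F x\<close>.\<close>
    with ln_neg have small: "eventually (\<lambda>x. \<Phi> (s x) + ln 2 \<le> (ln x)\<^sup>2) (at_right 0)"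
    proof eventually_elim
      case (elim x)
      then have "(ln x)\<^sup>2 > 0" by simp
      moreover have "\<Phi> (s x) / ln x * (1 / ln x) + ln 2 / (ln x)\<^sup>2 = (\<Phi> (s x) + ln 2) / (ln x)\<^sup>2"
        using elim by (simp add: field_simps power2_eq_square)
      ultimately show ?case using elim by (simp add: divide_less_eq)
    qed
    have F_ge: "eventually (\<lambda>x. F x \<ge> exp (- \<Phi> (s x)) / 2) (at_right 0)"
      using small s_gt x01
    proof eventually_elim
      case (elim x)
      have "exp (- s x * x) = exp (- (ln x)\<^sup>2)" using elim by (simp add: s_def)
      also have "\<dots> \<le> exp (- \<Phi> (s x) - ln 2)" using elim by simp
      also have "\<dots> = exp (- \<Phi> (s x)) / 2" by (simp add: exp_diff)
      finally show ?case using upper[of "s x" x] elim by simp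
    qed
    then have F_pos: "eventually (\<lambda>x. F x > 0) (at_right 0)"
      by eventually_elim (use exp_gt_zero in \<open>smt (verit) half_gt_zero\<close>)
    have "((\<lambda>x. ln (F x) / ln x) \<longlongrightarrow> \<gamma>) (at_right 0)"
    proof (rule tendsto_sandwich)
      \<comment> \<open>Division by \<open>ln x < 0\<close> reverses the order: the upper bound on
        \<open>F\<close> becomes the lower bound on the ratio.\<close>
      show "eventually (\<lambda>x. (1 - \<Phi> (1 / x)) / ln x \<le> ln (F x) / ln x) (at_right 0)"
        using F_pos x01
        by eventually_elim (auto intro!: divide_right_mono_neg ln_F_le)
      show "eventually (\<lambda>x. ln (F x) / ln x \<le> (- \<Phi> (s x) - ln 2) / ln x) (at_right 0)"
        using F_pos x01 F_ge
      proof eventually_elim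
        case (elim x)
        then have "ln (exp (- \<Phi> (s x)) / 2) \<le> ln (F x)" by (subst ln_le_cancel_iff) auto
        then show ?case using elim by (intro divide_right_mono_neg) (auto simp: ln_div)
      qed
      have "filterlim (\<lambda>x::real. 1 / x) at_top (at_right 0)" by real_asymp
      note * = filterlim_compose[OF lim this]
      have "((\<lambda>x. 1 / ln x + \<Phi> (1 / x) / ln (1 / x)) \<longlongrightarrow> 0 + \<gamma>) (at_right 0)"
        by (intro tendsto_add *) real_asymp
      moreover have "eventually (\<lambda>x. 1 / ln x + \<Phi> (1 / x) / ln (1 / x) = (1 - \<Phi> (1 / x)) / ln x) (at_right 0)"
        using x01 by eventually_elim (auto simp: ln_div field_simps)
      ultimately show "((\<lambda>x. (1 - \<Phi> (1 / x)) / ln x) \<longlongrightarrow> \<gamma>) (at_right 0)"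
        by (simp add: tendsto_cong)
      have "((\<lambda>x. - (\<Phi> (s x) / ln x) - ln 2 / ln x) \<longlongrightarrow> - (- \<gamma>) - 0) (at_right 0)"
        by (intro tendsto_diff tendsto_minus \<Phi>s; real_asymp)
      then show "((\<lambda>x. (- \<Phi> (s x) - ln 2) / ln x) \<longlongrightarrow> \<gamma>) (at_right 0)"
        by (simp add: diff_divide_distrib)
    qed
    with F_pos show "log_ratio_at_origin F \<gamma>" by (simp add: log_ratio_at_origin_def)
  next
    assume "log_ratio_at_origin F \<gamma>"
    then have F_pos: "eventually (\<lambda>x. F x > 0) (at_right 0)"
      and lim: "((\<lambda>x. ln (F x) / ln x) \<longlongrightarrow> \<gamma>) (at_right 0)"
      by (auto simp: log_ratio_at_origin_def)
    \<comment> \<open>The mirror image of the earlier choice: the error is now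
      \<open>exp (- (ln s)\<^sup>2)\<close>, while \<open>ln (F (x s))\<close> is only of order
      \<open>ln s\<close>, so the error is at most \<open>F (x s)\<close>.\<close>
    define x where "x = (\<lambda>s::real. (ln s)\<^sup>2 / s)"
    have x_0: "filterlim x (at_right 0) at_top" unfolding x_def by real_asymp
    have inv_0: "filterlim (\<lambda>s::real. 1 / s) (at_right 0) at_top" by real_asymp
    have F_pos_x: "eventually (\<lambda>s. F (x s) > 0) at_top" and F_pos_inv: "eventually (\<lambda>s. F (1 / s) > 0) at_top"
      using eventually_compose_filterlim[OF F_pos] x_0 inv_0 by auto
    have x01: "eventually (\<lambda>s. 0 < x s \<and> x s < 1) at_top"
      unfolding x_def eventually_conj_iff by (intro conjI; real_asymp)
    have s_gt: "eventually (\<lambda>s::real. ln s > 1 \<and> s > 1) at_top"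
      unfolding eventually_conj_iff by (intro conjI; real_asymp)
    have "((\<lambda>s. ln (F (x s)) / ln (x s) * (ln (x s) / ln s)) \<longlongrightarrow> \<gamma> * - 1) at_top"
    proof (intro tendsto_mult filterlim_compose[OF lim x_0])
      show "((\<lambda>s. ln (x s) / ln s) \<longlongrightarrow> - 1) at_top" unfolding x_def by real_asymp
    qed
    moreover have "eventually (\<lambda>s. ln (F (x s)) / ln (x s) * (ln (x s) / ln s) = ln (F (x s)) / ln s) at_top"
      using x01 by eventually_elim auto
    ultimately have "((\<lambda>s. ln (F (x s)) / ln s) \<longlongrightarrow> \<gamma> * - 1) at_top"
      by (rule Lim_transform_eventually)
    then have Fx: "((\<lambda>s. ln (F (x s)) / ln s) \<longlongrightarrow> - \<gamma>) at_top" by simp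
    have "((\<lambda>s. ln (F (x s)) / ln s * (1 / ln s)) \<longlongrightarrow> - \<gamma> * 0) at_top"
      by (intro tendsto_mult Fx) real_asymp
    then have "eventually (\<lambda>s. ln (F (x s)) / ln s * (1 / ln s) > - 1) at_top"
      by (intro order_tendstoD) auto
    with s_gt have small: "eventually (\<lambda>s. - (ln s)\<^sup>2 \<le> ln (F (x s))) at_top"
    proof eventually_elim
      case (elim s)
      then have "(ln s)\<^sup>2 > 0" by simp
      then show ?case using elim by (simp add: field_simps power2_eq_square)
    qed
    show "((\<lambda>s. \<Phi> s / ln s) \<longlongrightarrow> \<gamma>) at_top"
    proof (rule tendsto_sandwich)
      show "eventually (\<lambda>s. (- ln 2 - ln (F (x s))) / ln s \<le> \<Phi> s / ln s) at_top"
        using small s_gt x01 F_pos_x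
      proof eventually_elim
        case (elim s)
        have "exp (- s * x s) = exp (- (ln s)\<^sup>2)" using elim by (simp add: x_def)
        also have "\<dots> \<le> exp (ln (F (x s)))" using elim by (simp only: exp_le_cancel_iff)
        also have "\<dots> = F (x s)" using elim by simp
        finally have "exp (- \<Phi> s) \<le> 2 * F (x s)" using upper[of s "x s"] elim by simp
        then have "ln (exp (- \<Phi> s)) \<le> ln (2 * F (x s))" using elim by (subst ln_le_cancel_iff) auto
        then show ?case using elim by (intro divide_right_mono) (auto simp: ln_mult)
      qed
      show "eventually (\<lambda>s. \<Phi> s / ln s \<le> (1 - ln (F (1 / s))) / ln s) at_top"
        using F_pos_inv s_gt
      proof eventually_elim
        case (elim s)
        then show ?case using ln_F_le[of "1 / s"] by (intro divide_right_mono) auto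
      qed
      have "((\<lambda>s. - (ln 2 / ln s) - ln (F (x s)) / ln s) \<longlongrightarrow> - 0 - (- \<gamma>)) at_top"
        by (intro tendsto_diff tendsto_minus Fx) real_asymp
      then show "((\<lambda>s. (- ln 2 - ln (F (x s))) / ln s) \<longlongrightarrow> \<gamma>) at_top"
        by (simp add: diff_divide_distrib)
      have "((\<lambda>s. 1 / ln s + ln (F (1 / s)) / ln (1 / s)) \<longlongrightarrow> 0 + \<gamma>) at_top"
        by (intro tendsto_add filterlim_compose[OF lim inv_0]) real_asymp
      moreover have "eventually (\<lambda>s. 1 / ln s + ln (F (1 / s)) / ln (1 / s) = (1 - ln (F (1 / s))) / ln s) at_top"
        using s_gt by eventually_elim (auto simp: ln_div field_simps)
      ultimately show "((\<lambda>s. (1 - ln (F (1 / s))) / ln s) \<longlongrightarrow> \<gamma>) at_top"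
        by (simp add: tendsto_cong)
    qed
  }
qed

section \<open>The Laplace exponent and the tail of the Levy measure on the logarithmic
  scale\<close>

text \<open>From \<Phi> to the tail, \<open>laplace_exponent_ge\<close> and
  \<open>laplace_exponent_le_tail\<close> are enough, because the growth of \<Phi> at
  \<open>1 / x\<close> is then known. In the other direction the lower bound on \<Phi> is again
  \<open>laplace_exponent_ge\<close>, but the upper bound has to come from
  \<open>laplace_exponent_le_log\<close>.\<close>

lemma exponent_log_growth_iff_levy_tail:
  assumes L: "subordinator_levy_measure \<nu>" and \<gamma>: "\<gamma> > 0"
  shows "((\<lambda>s. laplace_exponent \<nu> s / ln s) \<longlongrightarrow> \<gamma>) at_top \<longleftrightarrow>
    ((\<lambda>x. levy_tail \<nu> x / ln x) \<longlongrightarrow> - \<gamma>) (at_right 0)"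
proof
  let ?\<Phi> = "laplace_exponent \<nu>"
  assume lim: "((\<lambda>s. ?\<Phi> s / ln s) \<longlongrightarrow> \<gamma>) at_top"
  \<comment> \<open>Two couplings with opposite aims. Since \<open>r x * x = - ln x\<close>
    diverges, the factor \<open>1 - exp (- r x * x)\<close> equals \<open>1 - x\<close> and tends to
    1. Since \<open>s x * x = 1 / (ln x)\<^sup>2\<close> vanishes, the correction containing \<Phi>
    at \<open>1 / x\<close>, which is of order \<open>ln (1 / x)\<close>, disappears. In both cases
    the logarithm of the parameter is asymptotic to \<open>- ln x\<close>.\<close>
  define r s :: "real \<Rightarrow> real" where "r x = - ln x / x" and "s x = 1 / (x * (ln x)\<^sup>2)" for x
  have r_top: "filterlim r at_top (at_right 0)" and s_top: "filterlim s at_top (at_right 0)"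
    unfolding r_def s_def by real_asymp+
  have inv_top: "filterlim (\<lambda>x::real. 1 / x) at_top (at_right 0)" by real_asymp
  have x01: "eventually (\<lambda>x::real. 0 < x \<and> x < 1) (at_right 0)"
    by (auto simp: eventually_at_right_field intro!: exI[of _ 1])
  have "((\<lambda>x. - (?\<Phi> (r x) / ln (r x)) * (ln (r x) / (- ln x * (1 - x)))) \<longlongrightarrow> - \<gamma> * 1) (at_right 0)"
    unfolding mult_minus_left
    by (intro tendsto_minus tendsto_mult filterlim_compose[OF lim r_top]) (unfold r_def, real_asymp)
  moreover have "eventually (\<lambda>x. r x > 1) (at_right 0)"
    using r_top by (simp add: filterlim_at_top_dense)
  then have "eventually (\<lambda>x. - (?\<Phi> (r x) / ln (r x)) * (ln (r x) / (- ln x * (1 - x)))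
      = ?\<Phi> (r x) / (1 - x) / ln x) (at_right 0)"
    using x01 by eventually_elim (auto simp: field_simps)
  ultimately have lower: "((\<lambda>x. ?\<Phi> (r x) / (1 - x) / ln x) \<longlongrightarrow> - \<gamma>) (at_right 0)"
    by (simp add: tendsto_cong)
  have "((\<lambda>x. ?\<Phi> (s x) / ln (s x) * (ln (s x) / ln x)
      - 2 * (?\<Phi> (1 / x) / ln (1 / x)) * (ln (1 / x) / (ln x)^3)) \<longlongrightarrow> \<gamma> * - 1 - 2 * \<gamma> * 0) (at_right 0)"
    by (intro tendsto_diff tendsto_mult tendsto_const filterlim_compose[OF lim s_top] filterlim_compose[OF lim inv_top])
      (unfold s_def, real_asymp+)
  moreover have "eventually (\<lambda>x. s x > 1) (at_right 0)"
    using s_top by (simp add: filterlim_at_top_dense)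
  then have "eventually (\<lambda>x. ?\<Phi> (s x) / ln (s x) * (ln (s x) / ln x)
      - 2 * (?\<Phi> (1 / x) / ln (1 / x)) * (ln (1 / x) / (ln x)^3)
      = (?\<Phi> (s x) - 2 * s x * x * ?\<Phi> (1 / x)) / ln x) (at_right 0)"
    using x01
  proof eventually_elim
    case (elim x)
    then have "ln x < 0" "ln (s x) > 0" "ln (1 / x) > 0" by auto
    moreover have "2 * s x * x = 2 / (ln x)\<^sup>2" using elim by (simp add: s_def)
    ultimately show ?case by (simp add: diff_divide_distrib power3_eq_cube power2_eq_square)
  qed
  ultimately have upper: "((\<lambda>x. (?\<Phi> (s x) - 2 * s x * x * ?\<Phi> (1 / x)) / ln x) \<longlongrightarrow> - \<gamma>) (at_right 0)"
    by (simp add: tendsto_cong)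
  show "((\<lambda>x. levy_tail \<nu> x / ln x) \<longlongrightarrow> - \<gamma>) (at_right 0)"
  proof (rule tendsto_sandwich[OF _ _ lower upper])
    show "eventually (\<lambda>x. ?\<Phi> (r x) / (1 - x) / ln x \<le> levy_tail \<nu> x / ln x) (at_right 0)"
      using x01
    proof eventually_elim
      case (elim x)
      then have "(1 - x) * levy_tail \<nu> x \<le> ?\<Phi> (r x)"
        using laplace_exponent_ge[OF L, of "r x" x] by (simp add: r_def divide_nonpos_pos)
      then have "levy_tail \<nu> x \<le> ?\<Phi> (r x) / (1 - x)" using elim by (simp add: field_simps)
      then show ?case using elim by (intro divide_right_mono_neg) auto
    qed
    show "eventually (\<lambda>x. levy_tail \<nu> x / ln x \<le> (?\<Phi> (s x) - 2 * s x * x * ?\<Phi> (1 / x)) / ln x) (at_right 0)"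
      using x01
    proof eventually_elim
      case (elim x)
      then show ?case
        using laplace_exponent_le_tail[OF L, of "s x" x]
        by (intro divide_right_mono_neg) (auto simp: s_def)
    qed
  qed
next
  let ?\<Phi> = "laplace_exponent \<nu>"
  assume lim: "((\<lambda>x. levy_tail \<nu> x / ln x) \<longlongrightarrow> - \<gamma>) (at_right 0)"
  \<comment> \<open>Chosen so that \<open>exp (- s * x s) = 1 / s\<close>.\<close>
  define x :: "real \<Rightarrow> real" where "x s = ln s / s" for s
  have x_0: "filterlim x (at_right 0) at_top" unfolding x_def by real_asymp
  have s_gt: "eventually (\<lambda>s::real. s > 1) at_top" by real_asymp
  have x01: "eventually (\<lambda>s. 0 < x s \<and> x s < 1) at_top"
    unfolding x_def eventually_conj_iff by (intro conjI; real_asymp)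
  have "((\<lambda>s. levy_tail \<nu> (x s) / ln (x s) * ((1 - 1 / s) * (ln (x s) / ln s))) \<longlongrightarrow> - \<gamma> * - 1) at_top"
    by (intro tendsto_mult filterlim_compose[OF lim x_0]) (unfold x_def, real_asymp)
  moreover have "eventually (\<lambda>s. levy_tail \<nu> (x s) / ln (x s) * ((1 - 1 / s) * (ln (x s) / ln s))
      = (1 - exp (- s * x s)) * levy_tail \<nu> (x s) / ln s) at_top"
    using x01 s_gt
  proof eventually_elim
    case (elim s)
    then have "ln (x s) \<noteq> 0" by auto
    moreover have "exp (- s * x s) = 1 / s"
      using elim by (simp add: x_def exp_minus field_simps)
    ultimately show ?case by simp
  qed
  ultimately have "((\<lambda>s. (1 - exp (- s * x s)) * levy_tail \<nu> (x s) / ln s) \<longlongrightarrow> - \<gamma> * - 1) at_top"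
    by (rule Lim_transform_eventually)
  then have lower: "((\<lambda>s. (1 - exp (- s * x s)) * levy_tail \<nu> (x s) / ln s) \<longlongrightarrow> \<gamma>) at_top" by simp
  show "((\<lambda>s. ?\<Phi> s / ln s) \<longlongrightarrow> \<gamma>) at_top"
  proof (rule order_tendstoI)
    fix a assume "a < \<gamma>"
    with lower have "eventually (\<lambda>s. a < (1 - exp (- s * x s)) * levy_tail \<nu> (x s) / ln s) at_top"
      by (rule order_tendstoD)
    then show "eventually (\<lambda>s. a < ?\<Phi> s / ln s) at_top"
      using s_gt x01
    proof eventually_elim
      case (elim s)
      then have "(1 - exp (- s * x s)) * levy_tail \<nu> (x s) / ln s \<le> ?\<Phi> s / ln s"
        by (intro divide_right_mono laplace_exponent_ge[OF L]) auto
      with elim show ?case by simp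
    qed
  next
    fix a assume a: "\<gamma> < a"
    \<comment> \<open>The slack below \<open>c\<close> turns the limit into a bound valid for all
      small \<open>x\<close>; the slack above it absorbs \<open>2 * ln 2 / ln s\<close>.\<close>
    define c where "c = (\<gamma> + a) / 2"
    have c: "\<gamma> < c" "c < a" using a by (auto simp: c_def)
    have "eventually (\<lambda>x. - c < levy_tail \<nu> x / ln x) (at_right 0)"
      using lim c by (intro order_tendstoD) auto
    then obtain d where d: "d > 0" "\<And>x. 0 < x \<Longrightarrow> x < d \<Longrightarrow> - c < levy_tail \<nu> x / ln x"
      by (auto simp: eventually_at_right_field)
    have "((\<lambda>s. c * (1 + 2 * ln 2 / ln s)) \<longlongrightarrow> c * (1 + 0)) at_top"
      by (intro tendsto_intros) real_asymp
    then have "eventually (\<lambda>s. c * (1 + 2 * ln 2 / ln s) < a) at_top"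
      using c by (intro order_tendstoD) auto
    then show "eventually (\<lambda>s. ?\<Phi> s / ln s < a) at_top"
      using eventually_gt_at_top[of "1 / d"] s_gt
    proof eventually_elim
      case (elim s)
      have "?\<Phi> s \<le> c * (ln s + 2 * ln 2)"
      proof (rule laplace_exponent_le_log[OF L])
        fix y assume y: "0 < y" "y < 1 / s"
        have "1 / s < d" using elim d by (simp add: field_simps)
        moreover have "1 / s < 1" using elim by simp
        ultimately have "y < d" "y < 1" using y by auto
        with d(2)[of y] y show "levy_tail \<nu> y \<le> c * (- ln y)"
          by (simp add: neg_less_divide_eq less_imp_le)
      qed (use elim c \<gamma> in auto)
      then have "?\<Phi> s / ln s \<le> c * (ln s + 2 * ln 2) / ln s"
        using elim by (intro divide_right_mono) auto
      also have "\<dots> = c * (1 + 2 * ln 2 / ln s)" using elim by (simp add: field_simps)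
      finally show ?case using elim by simp
    qed
  qed
qed

section \<open>Convergence in distribution of the power laws\<close>

lemma isCont_point_between:
  fixes f :: "real \<Rightarrow> real"
  assumes "mono f" "a < b"
  obtains x where "a < x" "x < b" "isCont f x"
  using open_minus_countable[OF mono_ctble_discont[OF assms(1)], of "{a<..<b}"] assms(2) by auto

text \<open>Convergence identifies a limit law only at its continuity points. These approach every
  point from the right, where both distribution functions are continuous.\<close>

lemma real_distribution_eqI_continuity_points:
  assumes \<mu>: "real_distribution \<mu>" and \<mu>': "real_distribution \<mu>'"
    and eq: "\<And>x. isCont (cdf \<mu>) x \<Longrightarrow> cdf \<mu> x = cdf \<mu>' x"
  shows "\<mu> = \<mu>'"
proof (rule cdf_unique[OF \<mu> \<mu>'], rule ext)
  interpret \<mu>: real_distribution \<mu> by fact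
  interpret \<mu>': real_distribution \<mu>' by fact
  fix x
  have mono: "mono (cdf \<mu>)" by (intro monoI \<mu>.cdf_nondecreasing)
  have "\<exists>y. x < y \<and> y < x + 1 / real (Suc n) \<and> isCont (cdf \<mu>) y" for n
    by (rule isCont_point_between[OF mono, of x "x + 1 / real (Suc n)"]) auto
  then obtain y where y: "\<And>n. x < y n" "\<And>n. y n < x + 1 / real (Suc n)" "\<And>n. isCont (cdf \<mu>) (y n)"
    by metis
  have "y \<longlonglongrightarrow> x"
  proof (rule tendsto_sandwich)
    show "\<forall>\<^sub>F n in sequentially. x \<le> y n" "\<forall>\<^sub>F n in sequentially. y n \<le> x + 1 / real (Suc n)"
      using y(1,2) by (auto intro!: always_eventually less_imp_le simp del: of_nat_Suc)
    show "(\<lambda>n. x + 1 / real (Suc n)) \<longlonglongrightarrow> x" by real_asymp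
  qed simp
  then have "filterlim y (at_right x) sequentially"
    using y(1) by (auto simp: filterlim_at intro!: always_eventually)
  moreover have "(cdf \<mu> \<longlongrightarrow> cdf \<mu> x) (at_right x)" "(cdf \<mu>' \<longlongrightarrow> cdf \<mu>' x) (at_right x)"
    using \<mu>.cdf_is_right_cont \<mu>'.cdf_is_right_cont by (auto simp: continuous_within)
  ultimately have "(\<lambda>n. cdf \<mu> (y n)) \<longlonglongrightarrow> cdf \<mu> x" "(\<lambda>n. cdf \<mu>' (y n)) \<longlonglongrightarrow> cdf \<mu>' x"
    using filterlim_compose by blast+
  then show "cdf \<mu> x = cdf \<mu>' x"
    using eq[OF y(3)] LIMSEQ_unique by simp
qed

text \<open>The two families are comparable only after an arbitrarily small shift of the argument,
  as in the Levy metric. Continuity of \<open>H\<close> at \<open>x\<close> absorbs the shift, and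
  the shifted point can be taken to be a continuity point. The hypotheses are symmetric in
  \<open>A\<close> and \<open>B\<close>, so that one lemma serves both directions.\<close>

lemma tendsto_continuity_points_sandwich:
  fixes A B :: "'i \<Rightarrow> real \<Rightarrow> real"
  assumes H: "mono H"
    and AB: "\<And>x z. 0 < z \<Longrightarrow> z < x \<Longrightarrow> \<exists>e. (e \<longlongrightarrow> 0) G \<and> (\<forall>\<^sub>F t in G. A t x \<le> B t z + e t)"
    and BA: "\<And>x z. 0 < z \<Longrightarrow> z < x \<Longrightarrow> \<exists>e. (e \<longlongrightarrow> 0) G \<and> (\<forall>\<^sub>F t in G. B t x \<le> A t z + e t)"
    and conv: "\<And>x. x > 0 \<Longrightarrow> isCont H x \<Longrightarrow> ((\<lambda>t. A t x) \<longlongrightarrow> 1 - H x) G"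
    and x: "x > 0" "isCont H x"
  shows "((\<lambda>t. B t x) \<longlongrightarrow> 1 - H x) G"
proof (rule order_tendstoI)
  have lim: "((\<lambda>y. 1 - H y) \<longlongrightarrow> 1 - H x) (at x)"
    using x(2) by (intro tendsto_intros) (simp add: isCont_def)
  {
    fix a assume "a < 1 - H x"
    with lim have "\<forall>\<^sub>F y in at x. a < 1 - H y" by (rule order_tendstoD)
    then obtain d where d: "d > 0" "\<And>y. y \<noteq> x \<Longrightarrow> dist y x < d \<Longrightarrow> a < 1 - H y"
      by (auto simp: eventually_at)
    \<comment> \<open>\<open>A\<close> at a point to the right of \<open>x\<close> bounds
      \<open>B\<close> at \<open>x\<close> from below. The other half takes a point to the left,
      kept positive by the maximum with 0.\<close>
    obtain y where y: "x < y" "y < x + d" "isCont H y"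
      using isCont_point_between[OF H, of x "x + d"] d(1) by auto
    obtain e where e: "(e \<longlongrightarrow> 0) G" "\<forall>\<^sub>F t in G. A t y \<le> B t x + e t"
      using AB[OF x(1) y(1)] by auto
    have "((\<lambda>t. A t y - e t) \<longlongrightarrow> 1 - H y - 0) G"
      using x y by (intro tendsto_diff conv e) auto
    moreover have "a < 1 - H y - 0" using d(2)[of y] y by (auto simp: dist_real_def)
    ultimately have "\<forall>\<^sub>F t in G. a < A t y - e t" by (rule order_tendstoD)
    with e(2) show "\<forall>\<^sub>F t in G. a < B t x" by eventually_elim simp
  }
  {
    fix a assume "1 - H x < a"
    with lim have "\<forall>\<^sub>F y in at x. 1 - H y < a" by (rule order_tendstoD)
    then obtain d where d: "d > 0" "\<And>y. y \<noteq> x \<Longrightarrow> dist y x < d \<Longrightarrow> 1 - H y < a"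
      by (auto simp: eventually_at)
    obtain y where y: "max 0 (x - d) < y" "y < x" "isCont H y"
      using isCont_point_between[OF H, of "max 0 (x - d)" x] d(1) x(1) by auto
    obtain e where e: "(e \<longlongrightarrow> 0) G" "\<forall>\<^sub>F t in G. B t x \<le> A t y + e t"
      using BA[of y x] y by auto
    have "((\<lambda>t. A t y + e t) \<longlongrightarrow> 1 - H y + 0) G"
      using y by (intro tendsto_add conv e) auto
    moreover have "1 - H y + 0 < a" using d(2)[of y] y by (auto simp: dist_real_def)
    ultimately have "\<forall>\<^sub>F t in G. A t y + e t < a" by (rule order_tendstoD)
    with e(2) show "\<forall>\<^sub>F t in G. B t x < a" by eventually_elim simp
  }
qed

text \<open>Convergence in the extended reals, including the value infinity, becomes convergence of
  Laplace transforms, which is what the probability bounds speak about.\<close>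

lemma neg_log_tendsto_iff:
  assumes "p \<ge> 0"
  shows "((\<lambda>t. ereal (h t)) \<longlongrightarrow> neg_log p) G \<longleftrightarrow> ((\<lambda>t. exp (- h t)) \<longlongrightarrow> p) G"
proof (cases "p = 0")
  case True
  have "filterlim h at_top G \<longleftrightarrow> ((\<lambda>t. exp (- h t)) \<longlongrightarrow> 0) G"
  proof
    assume "filterlim h at_top G"
    then have "filterlim (\<lambda>t. - h t) at_bot G" by (simp add: filterlim_uminus_at_top)
    then show "((\<lambda>t. exp (- h t)) \<longlongrightarrow> 0) G" by (rule filterlim_compose[OF exp_at_bot])
  next
    assume *: "((\<lambda>t. exp (- h t)) \<longlongrightarrow> 0) G"
    show "filterlim h at_top G"
      unfolding filterlim_at_top_dense
    proof
      fix Z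
      have "\<forall>\<^sub>F t in G. exp (- h t) < exp (- Z)" using * by (rule order_tendstoD) simp
      then show "\<forall>\<^sub>F t in G. Z < h t" by eventually_elim simp
    qed
  qed
  then show ?thesis using True by (simp add: neg_log_def tendsto_PInfty_eq_at_top)
next
  case False
  then have p: "p > 0" using assms by simp
  have "(h \<longlongrightarrow> - ln p) G \<longleftrightarrow> ((\<lambda>t. exp (- h t)) \<longlongrightarrow> p) G"
  proof
    assume "(h \<longlongrightarrow> - ln p) G"
    then have "((\<lambda>t. exp (- h t)) \<longlongrightarrow> exp (- (- ln p))) G" by (intro tendsto_intros)
    then show "((\<lambda>t. exp (- h t)) \<longlongrightarrow> p) G" using p by simp
  next
    assume "((\<lambda>t. exp (- h t)) \<longlongrightarrow> p) G"
    then have "((\<lambda>t. - ln (exp (- h t))) \<longlongrightarrow> - ln p) G" using p by (intro tendsto_intros) auto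
    then show "(h \<longlongrightarrow> - ln p) G" by simp
  qed
  then show ?thesis using False by (simp add: neg_log_def)
qed

lemma neg_log_inj:
  assumes "neg_log p = neg_log q" "p \<ge> 0" "q \<ge> 0"
  shows "p = q"
  using assms by (auto simp: neg_log_def split: if_splits)

text \<open>Almost surely \<open>Y t powr (- t) > x\<close> means \<open>Y t < y\<close> with
  \<open>y = x powr (- (1 / t))\<close>. At \<open>s = z powr (1 / t)\<close> the product
  \<open>s * y\<close> is \<open>(z / x) powr (1 / t)\<close>, which for small \<open>t\<close>
  tends to 0 if \<open>z < x\<close> and to infinity if \<open>z > x\<close>. The first bound is
  therefore sharp for \<open>z < x\<close>, the second for \<open>z > x\<close>.\<close>

lemma power_law_sandwich:
  assumes sub: "driftless_subordinator M Y \<nu>" and pos: "AE \<omega> in M. 0 < Y t \<omega>"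
    and t: "t > 0" and x: "x > 0" and z: "z > 0"
  shows "(1 - cdf (power_law M Y t) x) * exp (- ((z / x) powr (1 / t)))
      \<le> exp (- (t * laplace_exponent \<nu> (z powr (1 / t))))" (is "?a * ?e \<le> ?g")
    and "exp (- (t * laplace_exponent \<nu> (z powr (1 / t))))
      \<le> 1 - cdf (power_law M Y t) x + exp (- ((z / x) powr (1 / t)))"
proof -
  interpret driftless_subordinator M Y \<nu> by fact
  have Y [measurable]: "random_variable borel (Y t)" using random_variable_Y t by simp
  define y s where "y = x powr (- (1 / t))" and "s = z powr (1 / t)"
  have s: "s \<ge> 0" by (simp add: s_def)
  have less_iff: "x < v powr (- t) \<longleftrightarrow> v < y" if "v > 0" for v
  proof -
    have "x < v powr (- t) \<longleftrightarrow> ln x < - t * ln v"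
      using ln_less_cancel_iff[of x "v powr (- t)"] x that by (simp add: ln_powr)
    also have "\<dots> \<longleftrightarrow> ln v < - (1 / t) * ln x" using t by (auto simp: field_simps)
    also have "\<dots> \<longleftrightarrow> v < y"
      using ln_less_cancel_iff[of v y] x that by (simp add: ln_powr y_def)
    finally show ?thesis .
  qed
  have "1 - cdf (power_law M Y t) x = prob (space M - {\<omega> \<in> space M. Y t \<omega> powr (- t) \<le> x})"
    by (subst prob_compl) (auto simp: cdf_def power_law_def measure_distr vimage_def Int_def conj_commute)
  also have "\<dots> = prob {\<omega> \<in> space M. Y t \<omega> < y}"
    using pos by (intro finite_measure_eq_AE) (auto elim!: eventually_mono simp: less_iff[symmetric] not_le)
  finally have a: "?a = prob {\<omega> \<in> space M. Y t \<omega> < y}" .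
  have e: "?e = exp (- s * y)"
    using x z by (simp add: s_def y_def powr_divide powr_minus_divide)
  have g: "?g = expectation (\<lambda>\<omega>. exp (- s * Y t \<omega>))"
    using laplace_transform[of t s] t s by (simp add: s_def)
  show "?a * ?e \<le> ?g"
    unfolding a e g
    by (rule order_trans[OF mult_right_mono[OF prob_less_le_prob_le[OF Y]] laplace_ge_prob_le[OF Y pos s]]) simp
  show "?g \<le> ?a + ?e"
    unfolding a e g using laplace_le_prob_less[OF Y pos s] .
qed

lemma cdf_power_law_nonpos:
  assumes sub: "driftless_subordinator M Y \<nu>" and pos: "AE \<omega> in M. 0 < Y t \<omega>"
    and t: "t > 0" and x: "x \<le> 0"
  shows "cdf (power_law M Y t) x = 0"
proof -
  interpret driftless_subordinator M Y \<nu> by fact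
  have Y [measurable]: "random_variable borel (Y t)" using random_variable_Y t by simp
  have "cdf (power_law M Y t) x = prob {\<omega> \<in> space M. Y t \<omega> powr (- t) \<le> x}"
    by (auto simp: cdf_def power_law_def measure_distr vimage_def Int_def conj_commute)
  also have "\<dots> = prob {}"
    using pos by (intro finite_measure_eq_AE) (auto elim!: eventually_mono simp: not_le intro: le_less_trans[OF x])
  finally show ?thesis by simp
qed

text \<open>As \<open>t \<rightarrow> 0\<close>, the function \<open>v \<mapsto> exp (- (x / v) powr (1 / t))\<close> tends to the indicator of \<open>(x, \<infinity>)\<close>,
  so the Laplace transform of \<open>Y t\<close> at \<open>x powr (1 / t)\<close> approximates the tail at \<open>x\<close> of the power law.\<close>

lemma weak_conv_power_law_iff:
  assumes sub: "driftless_subordinator M Y \<nu>" and pos: "\<And>t. t > 0 \<Longrightarrow> AE \<omega> in M. 0 < Y t \<omega>"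
    and \<mu>: "real_distribution \<mu>" and \<mu>0: "cdf \<mu> 0 = 0"
  shows "weak_conv_filter (power_law M Y) \<mu> (at_right 0) \<longleftrightarrow> scaled_exponent_converges \<nu> (cdf \<mu>)"
proof -
  interpret \<mu>: real_distribution \<mu> by fact
  define A B where "A t x = 1 - cdf (power_law M Y t) x"
    and "B t x = exp (- (t * laplace_exponent \<nu> (x powr (1 / t))))" for t x :: real
  have H: "mono (cdf \<mu>)" by (intro monoI \<mu>.cdf_nondecreasing)
  have ev_pos: "\<forall>\<^sub>F t :: real in at_right 0. t > 0" by (rule eventually_at_right_less)
  have AB: "\<exists>e. (e \<longlongrightarrow> 0) (at_right 0) \<and> (\<forall>\<^sub>F t in at_right 0. A t x \<le> B t z + e t)"
    if z: "0 < z" "z < x" for x z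
  proof (intro exI conjI)
    define l where "l = ln (z / x)"
    have "l < 0" using z by (auto simp: l_def)
    then have "((\<lambda>t. exp (exp (l / t)) - 1) \<longlongrightarrow> 0) (at_right 0)" by real_asymp
    then show "((\<lambda>t. exp ((z / x) powr (1 / t)) - 1) \<longlongrightarrow> 0) (at_right 0)"
      using z by (simp add: powr_def l_def)
    show "\<forall>\<^sub>F t in at_right 0. A t x \<le> B t z + (exp ((z / x) powr (1 / t)) - 1)"
      using ev_pos
    proof eventually_elim
      case (elim t)
      let ?q = "(z / x) powr (1 / t)"
      have "A t x * exp (- ?q) \<le> B t z"
        unfolding A_def B_def using power_law_sandwich(1)[OF sub pos[OF elim] elim, of x z] z by simp
      then have "A t x * exp (- ?q) * exp ?q \<le> B t z * exp ?q" by (intro mult_right_mono) auto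
      then have "A t x \<le> B t z * exp ?q" by (simp add: mult.assoc exp_add[symmetric])
      \<comment> \<open>Because \<open>B t z \<le> 1\<close>, the multiplicative error turns into
        the additive error that the sandwich lemma expects.\<close>
      also have "\<dots> = B t z + B t z * (exp ?q - 1)" by (simp add: algebra_simps)
      also have "B t z * (exp ?q - 1) \<le> 1 * (exp ?q - 1)"
        using elim laplace_exponent_nonneg[of "z powr (1 / t)" \<nu>]
        by (intro mult_right_mono) (auto simp: B_def)
      finally show ?case by simp
    qed
  qed
  have BA: "\<exists>e. (e \<longlongrightarrow> 0) (at_right 0) \<and> (\<forall>\<^sub>F t in at_right 0. B t x \<le> A t z + e t)"
    if z: "0 < z" "z < x" for x z
  proof (intro exI conjI)
    define l where "l = ln (x / z)"
    have "l > 0" using z by (auto simp: l_def)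
    then have "((\<lambda>t. exp (- exp (l / t))) \<longlongrightarrow> 0) (at_right 0)" by real_asymp
    then show "((\<lambda>t. exp (- ((x / z) powr (1 / t)))) \<longlongrightarrow> 0) (at_right 0)"
      using z by (simp add: powr_def l_def)
    show "\<forall>\<^sub>F t in at_right 0. B t x \<le> A t z + exp (- ((x / z) powr (1 / t)))"
      using ev_pos
    proof eventually_elim
      case (elim t)
      then show ?case
        unfolding A_def B_def using power_law_sandwich(2)[OF sub pos[OF elim] elim, of z x] z by simp
    qed
  qed
  have "weak_conv_filter (power_law M Y) \<mu> (at_right 0) \<longleftrightarrow>
      (\<forall>x>0. isCont (cdf \<mu>) x \<longrightarrow> ((\<lambda>t. A t x) \<longlongrightarrow> 1 - cdf \<mu> x) (at_right 0))"
  proof -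
    \<comment> \<open>Convergence of the scaled exponents concerns positive arguments only; at the
      others both distribution functions vanish.\<close>
    have nonpos: "((\<lambda>t. cdf (power_law M Y t) x) \<longlongrightarrow> cdf \<mu> x) (at_right 0)" if "x \<le> 0" for x
    proof -
      have "cdf \<mu> x = 0" using \<mu>.cdf_nondecreasing[OF that] \<mu>0 \<mu>.cdf_nonneg[of x] by simp
      moreover have "\<forall>\<^sub>F t in at_right 0. cdf (power_law M Y t) x = 0"
        using ev_pos
      proof eventually_elim
        case (elim t)
        then show ?case by (rule cdf_power_law_nonpos[OF sub pos[OF elim] _ that])
      qed
      ultimately show ?thesis by (simp add: tendsto_eventually)
    qed
    have iff: "((\<lambda>t. cdf (power_law M Y t) x) \<longlongrightarrow> cdf \<mu> x) (at_right 0) \<longleftrightarrow>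
        ((\<lambda>t. A t x) \<longlongrightarrow> 1 - cdf \<mu> x) (at_right 0)" for x
    proof
      assume "((\<lambda>t. cdf (power_law M Y t) x) \<longlongrightarrow> cdf \<mu> x) (at_right 0)"
      then show "((\<lambda>t. A t x) \<longlongrightarrow> 1 - cdf \<mu> x) (at_right 0)"
        unfolding A_def by (intro tendsto_diff tendsto_const)
    next
      assume "((\<lambda>t. A t x) \<longlongrightarrow> 1 - cdf \<mu> x) (at_right 0)"
      then have "((\<lambda>t. 1 - A t x) \<longlongrightarrow> 1 - (1 - cdf \<mu> x)) (at_right 0)"
        by (intro tendsto_diff tendsto_const)
      then show "((\<lambda>t. cdf (power_law M Y t) x) \<longlongrightarrow> cdf \<mu> x) (at_right 0)"
        by (simp add: A_def)
    qed
    have restrict: "(\<forall>x. C x \<longrightarrow> P x) \<longleftrightarrow> (\<forall>x>0. C x \<longrightarrow> P x)"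
      if "\<And>x. x \<le> 0 \<Longrightarrow> P x" for C P :: "real \<Rightarrow> bool"
      using that by (meson not_le)
    show ?thesis
      unfolding weak_conv_filter_def iff[symmetric] by (rule restrict[OF nonpos])
  qed
  also have "\<dots> \<longleftrightarrow> (\<forall>x>0. isCont (cdf \<mu>) x \<longrightarrow> ((\<lambda>t. B t x) \<longlongrightarrow> 1 - cdf \<mu> x) (at_right 0))"
  proof (intro iffI allI impI)
    fix x :: real
    assume *: "\<forall>x>0. isCont (cdf \<mu>) x \<longrightarrow> ((\<lambda>t. A t x) \<longlongrightarrow> 1 - cdf \<mu> x) (at_right 0)"
      and x: "0 < x" "isCont (cdf \<mu>) x"
    show "((\<lambda>t. B t x) \<longlongrightarrow> 1 - cdf \<mu> x) (at_right 0)"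
      by (rule tendsto_continuity_points_sandwich[OF H AB BA *[rule_format] x])
  next
    fix x :: real
    assume *: "\<forall>x>0. isCont (cdf \<mu>) x \<longrightarrow> ((\<lambda>t. B t x) \<longlongrightarrow> 1 - cdf \<mu> x) (at_right 0)"
      and x: "0 < x" "isCont (cdf \<mu>) x"
    show "((\<lambda>t. A t x) \<longlongrightarrow> 1 - cdf \<mu> x) (at_right 0)"
      by (rule tendsto_continuity_points_sandwich[OF H BA AB *[rule_format] x])
  qed
  also have "\<dots> \<longleftrightarrow> scaled_exponent_converges \<nu> (cdf \<mu>)"
  proof -
    have "((\<lambda>t. ereal (t * laplace_exponent \<nu> (x powr (1 / t)))) \<longlongrightarrow> neg_log (1 - cdf \<mu> x)) (at_right 0) \<longleftrightarrow>
        ((\<lambda>t. B t x) \<longlongrightarrow> 1 - cdf \<mu> x) (at_right 0)" for x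
      unfolding B_def by (rule neg_log_tendsto_iff) (use \<mu>.cdf_bounded_prob[of x] in simp)
    then show ?thesis unfolding scaled_exponent_converges_def by simp
  qed
  finally show ?thesis .
qed

section \<open>Identification of the limit as a Pareto law\<close>

lemma scaled_exponent_tendsto:
  fixes \<Phi> :: "real \<Rightarrow> real"
  assumes lim: "((\<lambda>s. \<Phi> s / ln s) \<longlongrightarrow> c) at_top" and u: "u > 1"
  shows "((\<lambda>t. t * \<Phi> (u powr (1 / t))) \<longlongrightarrow> c * ln u) (at_right 0)"
proof -
  define l where "l = ln u"
  have l: "l > 0" using u by (simp add: l_def)
  then have "filterlim (\<lambda>t. exp (l / t)) at_top (at_right 0)" by real_asymp
  then have s: "filterlim (\<lambda>t. u powr (1 / t)) at_top (at_right 0)" using u by (simp add: powr_def l_def)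
  have "((\<lambda>t. \<Phi> (u powr (1 / t)) / ln (u powr (1 / t)) * ln u) \<longlongrightarrow> c * ln u) (at_right 0)"
    by (intro tendsto_mult tendsto_const filterlim_compose[OF lim s])
  moreover have "\<forall>\<^sub>F t in at_right 0. \<Phi> (u powr (1 / t)) / ln (u powr (1 / t)) * ln u = t * \<Phi> (u powr (1 / t))"
    using eventually_at_right_less[of "0::real"]
    by eventually_elim (use u l in \<open>simp add: ln_powr l_def\<close>)
  ultimately show ?thesis by (rule Lim_transform_eventually)
qed

lemma exponent_log_growth:
  fixes \<Phi> :: "real \<Rightarrow> real"
  assumes lim: "((\<lambda>t. t * \<Phi> (u powr (1 / t))) \<longlongrightarrow> c) (at_right 0)" and u: "u > 1"
  shows "((\<lambda>s. \<Phi> s / ln s) \<longlongrightarrow> c / ln u) at_top"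
proof -
  define l where "l = ln u"
  have l: "l > 0" using u by (simp add: l_def)
  then have t: "filterlim (\<lambda>s. l / ln s) (at_right 0) at_top" by real_asymp
  have "((\<lambda>s. l / ln s * \<Phi> (u powr (1 / (l / ln s))) * (1 / l)) \<longlongrightarrow> c * (1 / l)) at_top"
    by (intro tendsto_mult tendsto_const filterlim_compose[OF lim t])
  moreover have "\<forall>\<^sub>F s in at_top. l / ln s * \<Phi> (u powr (1 / (l / ln s))) * (1 / l) = \<Phi> s / ln s"
    using eventually_gt_at_top[of 1]
  proof eventually_elim
    case (elim s)
    then have "u powr (1 / (l / ln s)) = s" using u l by (simp add: powr_def l_def)
    then show ?case using l by simp
  qed
  ultimately have "((\<lambda>s. \<Phi> s / ln s) \<longlongrightarrow> c * (1 / l)) at_top" by (rule Lim_transform_eventually)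
  then show ?thesis by (simp add: l_def)
qed

text \<open>The argument \<open>u powr (1 / t)\<close> stays in the unit interval, so \<Phi> stays
  bounded by its value at 1 and the factor \<open>t\<close> wins. This is why every limit law lives
  on \<open>[1, \<infinity>)\<close>.\<close>

lemma scaled_exponent_tendsto_zero:
  assumes L: "subordinator_levy_measure \<nu>" and u: "0 < u" "u \<le> 1"
  shows "((\<lambda>t. t * laplace_exponent \<nu> (u powr (1 / t))) \<longlongrightarrow> 0) (at_right 0)"
proof (rule tendsto_sandwich)
  show "\<forall>\<^sub>F t in at_right 0. 0 \<le> t * laplace_exponent \<nu> (u powr (1 / t))"
    using eventually_at_right_less[of "0::real"]
    by eventually_elim (simp add: laplace_exponent_nonneg)
  show "\<forall>\<^sub>F t in at_right 0. t * laplace_exponent \<nu> (u powr (1 / t)) \<le> t * laplace_exponent \<nu> 1"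
    using eventually_at_right_less[of "0::real"]
    by eventually_elim (use u in \<open>auto intro!: mult_left_mono laplace_exponent_mono[OF L] powr_le1\<close>)
  have "((\<lambda>t. t * laplace_exponent \<nu> 1) \<longlongrightarrow> 0 * laplace_exponent \<nu> 1) (at_right 0)"
    by (intro tendsto_intros)
  then show "((\<lambda>t. t * laplace_exponent \<nu> 1) \<longlongrightarrow> 0) (at_right 0)" by simp
qed simp

lemma scaled_exponent_converges_pareto_iff:
  assumes L: "subordinator_levy_measure \<nu>" and \<gamma>: "\<gamma> > 0"
  shows "scaled_exponent_converges \<nu> (cdf (pareto \<gamma>)) \<longleftrightarrow>
    ((\<lambda>s. laplace_exponent \<nu> s / ln s) \<longlongrightarrow> \<gamma>) at_top"
proof
  have eq: "neg_log (1 - cdf (pareto \<gamma>) u) = ereal (\<gamma> * ln (max 1 u))" if "u > 0" for u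
    using that \<gamma> by (auto simp: cdf_pareto pareto_cdf_def neg_log_def ln_powr max_def)
  {
    assume *: "scaled_exponent_converges \<nu> (cdf (pareto \<gamma>))"
    \<comment> \<open>One point beyond 1 suffices; at \<open>exp 1\<close> the limit
      \<open>\<gamma> * ln u\<close> is \<gamma> itself.\<close>
    have "isCont (\<lambda>x. 1 - x powr (- \<gamma>)) (exp 1)" by (intro continuous_intros) auto
    moreover have "\<forall>\<^sub>F x in nhds (exp 1 :: real). x > 1"
      using eventually_nhds_in_open[of "{1<..}" "exp 1 :: real"] by simp
    then have "\<forall>\<^sub>F x in nhds (exp 1). 1 - x powr (- \<gamma>) = cdf (pareto \<gamma>) x"
      by eventually_elim (simp add: cdf_pareto[OF \<gamma>] pareto_cdf_def)
    ultimately have "isCont (cdf (pareto \<gamma>)) (exp 1)" by (simp only: isCont_cong)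
    with * have "((\<lambda>t. ereal (t * laplace_exponent \<nu> (exp 1 powr (1 / t))))
        \<longlongrightarrow> neg_log (1 - cdf (pareto \<gamma>) (exp 1))) (at_right 0)"
      unfolding scaled_exponent_converges_def by auto
    then have "((\<lambda>t. t * laplace_exponent \<nu> (exp 1 powr (1 / t))) \<longlongrightarrow> \<gamma>) (at_right 0)"
      by (subst (asm) eq) (auto simp: max_def)
    from exponent_log_growth[OF this]
    show "((\<lambda>s. laplace_exponent \<nu> s / ln s) \<longlongrightarrow> \<gamma>) at_top" by simp
  next
    assume lim: "((\<lambda>s. laplace_exponent \<nu> s / ln s) \<longlongrightarrow> \<gamma>) at_top"
    show "scaled_exponent_converges \<nu> (cdf (pareto \<gamma>))"
      unfolding scaled_exponent_converges_def
    proof (intro allI impI)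
      fix u :: real assume "u > 0"
      then show "((\<lambda>t. ereal (t * laplace_exponent \<nu> (u powr (1 / t)))) \<longlongrightarrow> neg_log (1 - cdf (pareto \<gamma>) u)) (at_right 0)"
        using scaled_exponent_tendsto[OF lim, of u] scaled_exponent_tendsto_zero[OF L, of u]
        by (cases "u > 1") (auto simp: eq max_def)
    qed
  }
qed

lemma nondegenerate_positive_rv_distr:
  assumes "nondegenerate_positive_rv N Z"
  shows "real_distribution (distr N borel Z)" and "cdf (distr N borel Z) 0 = 0"
proof -
  interpret N: prob_space N using assms by (simp add: nondegenerate_positive_rv_def)
  have Z [measurable]: "Z \<in> borel_measurable N" and pos: "AE \<omega> in N. 0 < Z \<omega>"
    using assms by (auto simp: nondegenerate_positive_rv_def)
  show "real_distribution (distr N borel Z)" by (intro N.real_distribution_distr Z)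
  have "cdf (distr N borel Z) 0 = N.prob {\<omega> \<in> space N. Z \<omega> \<le> 0}"
    by (auto simp: cdf_def measure_distr vimage_def Int_def conj_commute)
  also have "\<dots> = N.prob {}"
    using pos by (intro N.finite_measure_eq_AE) (auto elim!: eventually_mono)
  finally show "cdf (distr N borel Z) 0 = 0" by simp
qed

text \<open>If the distribution function jumped from 0 to 1 at \<open>c\<close>, its left limit
  there, the mass of \<open>{..<c}\<close>, would be 0 and all mass would sit at
  \<open>c\<close>.\<close>

lemma nondegenerate_positive_rv_not_point_mass:
  assumes Z: "nondegenerate_positive_rv N Z" and below: "\<And>u. u < c \<Longrightarrow> cdf (distr N borel Z) u = 0"
  shows "cdf (distr N borel Z) c < 1"
proof (rule ccontr)
  let ?\<mu> = "distr N borel Z"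
  interpret \<mu>: real_distribution ?\<mu> by (rule nondegenerate_positive_rv_distr[OF Z])
  assume "\<not> cdf ?\<mu> c < 1"
  then have 1: "cdf ?\<mu> c = 1" using \<mu>.cdf_bounded_prob[of c] by simp
  have "\<forall>\<^sub>F u in at_left c. cdf ?\<mu> u = 0"
    using below by (auto simp: eventually_at_left_field intro!: exI[of _ "c - 1"])
  then have "(cdf ?\<mu> \<longlongrightarrow> 0) (at_left c)" by (rule tendsto_eventually)
  then have 0: "measure ?\<mu> {..<c} = 0"
    by (rule tendsto_unique[OF trivial_limit_at_left_real \<mu>.cdf_at_left])
  have "cdf ?\<mu> c = measure ?\<mu> {..<c} + measure ?\<mu> {c}"
    unfolding cdf_def ivl_disj_un(2)[symmetric] by (subst \<mu>.finite_measure_Union) auto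
  then have "measure ?\<mu> {c} = 1" using 0 1 by simp
  then have "AE x in ?\<mu>. x \<in> {c}" by (rule \<mu>.AE_prob_1)
  moreover have "Z \<in> borel_measurable N" using Z by (simp add: nondegenerate_positive_rv_def)
  ultimately have "AE \<omega> in N. Z \<omega> \<in> {c}" by (rule AE_distrD[rotated])
  then show False using Z by (auto simp: nondegenerate_positive_rv_def)
qed

lemma scaled_exponent_limit_is_pareto:
  assumes L: "subordinator_levy_measure \<nu>" and Z: "nondegenerate_positive_rv N Z"
    and conv: "scaled_exponent_converges \<nu> (cdf (distr N borel Z))"
  obtains \<gamma> where "\<gamma> > 0" "((\<lambda>s. laplace_exponent \<nu> s / ln s) \<longlongrightarrow> \<gamma>) at_top" "distr N borel Z = pareto \<gamma>"
proof -
  let ?\<mu> = "distr N borel Z" and ?\<Phi> = "laplace_exponent \<nu>"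
  interpret \<mu>: real_distribution ?\<mu> by (rule nondegenerate_positive_rv_distr[OF Z])
  have \<mu>0: "cdf ?\<mu> 0 = 0" by (rule nondegenerate_positive_rv_distr[OF Z])
  have mono: "mono (cdf ?\<mu>)" by (intro monoI \<mu>.cdf_nondecreasing)
  have nonpos: "cdf ?\<mu> u = 0" if "u \<le> 0" for u
    using \<mu>.cdf_nondecreasing[OF that] \<mu>.cdf_nonneg[of u] \<mu>0 by simp
  have unique: "neg_log (1 - cdf ?\<mu> u) = ereal a"
    if "((\<lambda>t. t * ?\<Phi> (u powr (1 / t))) \<longlongrightarrow> a) (at_right 0)" "u > 0" "isCont (cdf ?\<mu>) u" for u a
  proof (rule tendsto_unique[OF trivial_limit_at_right_real])
    show "((\<lambda>t. ereal (t * ?\<Phi> (u powr (1 / t)))) \<longlongrightarrow> neg_log (1 - cdf ?\<mu> u)) (at_right 0)"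
      using conv that unfolding scaled_exponent_converges_def by blast
    show "((\<lambda>t. ereal (t * ?\<Phi> (u powr (1 / t)))) \<longlongrightarrow> ereal a) (at_right 0)"
      using that(1) by simp
  qed
  have cdf_eq: "cdf ?\<mu> u = 1 - exp (- a)"
    if "((\<lambda>t. t * ?\<Phi> (u powr (1 / t))) \<longlongrightarrow> a) (at_right 0)" "u > 0" "isCont (cdf ?\<mu>) u" for u a
    using neg_log_inj[of "1 - cdf ?\<mu> u" "exp (- a)"] unique[OF that] \<mu>.cdf_bounded_prob[of u]
    by (simp add: neg_log_def)
  have below1: "cdf ?\<mu> u = 0" if "u < 1" for u
  proof -
    obtain v where v: "max 0 u < v" "v < 1" "isCont (cdf ?\<mu>) v"
      using isCont_point_between[OF mono, of "max 0 u" 1] \<open>u < 1\<close> by auto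
    then have "cdf ?\<mu> v = 0" using cdf_eq[OF scaled_exponent_tendsto_zero[OF L, of v]] by simp
    then show ?thesis using \<mu>.cdf_nondecreasing[of u v] \<mu>.cdf_nonneg[of u] v by simp
  qed
  \<comment> \<open>This excludes an infinite exponent. By right-continuity there is then a
    continuity point \<open>u > 1\<close> at which \<open>neg_log\<close> of the tail is finite, and
    that single finite limit determines \<gamma>.\<close>
  have "cdf ?\<mu> 1 < 1" by (rule nondegenerate_positive_rv_not_point_mass[OF Z below1])
  moreover have "(cdf ?\<mu> \<longlongrightarrow> cdf ?\<mu> 1) (at_right 1)"
    using \<mu>.cdf_is_right_cont[of 1] by (simp add: continuous_within)
  ultimately have "\<forall>\<^sub>F u in at_right 1. cdf ?\<mu> u < 1" by (intro order_tendstoD) auto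
  then obtain b where b: "b > 1" "\<And>u. 1 < u \<Longrightarrow> u < b \<Longrightarrow> cdf ?\<mu> u < 1"
    by (auto simp: eventually_at_right_field)
  obtain u where u: "1 < u" "u < b" "isCont (cdf ?\<mu>) u"
    using isCont_point_between[OF mono b(1)] by auto
  have "neg_log (1 - cdf ?\<mu> u) = ereal (- ln (1 - cdf ?\<mu> u))"
    using b(2)[OF u(1,2)] by (simp add: neg_log_def)
  then have "((\<lambda>t. ereal (t * ?\<Phi> (u powr (1 / t)))) \<longlongrightarrow> ereal (- ln (1 - cdf ?\<mu> u))) (at_right 0)"
    using conv u unfolding scaled_exponent_converges_def by (metis less_trans zero_less_one)
  then have "((\<lambda>t. t * ?\<Phi> (u powr (1 / t))) \<longlongrightarrow> - ln (1 - cdf ?\<mu> u)) (at_right 0)" by simp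
  from exponent_log_growth[OF this u(1)]
  obtain \<gamma> where \<gamma>: "((\<lambda>s. ?\<Phi> s / ln s) \<longlongrightarrow> \<gamma>) at_top" and \<gamma>_eq: "\<gamma> = - ln (1 - cdf ?\<mu> u) / ln u" by blast
  have "\<gamma> \<ge> 0"
    unfolding \<gamma>_eq using u(1) b(2)[OF u(1,2)] \<mu>.cdf_nonneg[of u]
    by (intro divide_nonneg_pos) auto
  \<comment> \<open>With \<gamma> equal to 0 the distribution function would vanish at continuity
    points arbitrarily far out, contradicting its limit 1 at infinity.\<close>
  moreover have "\<gamma> \<noteq> 0"
  proof
    assume "\<gamma> = 0"
    have "\<forall>\<^sub>F v in at_top. cdf ?\<mu> v > 0"
      using \<mu>.cdf_lim_at_top_prob by (rule order_tendstoD) simp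
    then obtain v where v: "v > 1" "cdf ?\<mu> v > 0"
      using eventually_happens'[OF trivial_limit_at_top_linorder eventually_conj[OF eventually_gt_at_top[of 1]]] by blast
    obtain w where w: "v < w" "isCont (cdf ?\<mu>) w"
      using isCont_point_between[OF mono, of v "v + 1"] by auto
    have "cdf ?\<mu> w = 0"
      using cdf_eq[OF scaled_exponent_tendsto[OF \<gamma>, of w]] v w \<open>\<gamma> = 0\<close> by simp
    then show False using v w \<mu>.cdf_nondecreasing[of v w] by simp
  qed
  ultimately have pos: "\<gamma> > 0" by simp
  show thesis
  proof (rule that[OF pos \<gamma>], rule real_distribution_eqI_continuity_points[OF \<mu>.real_distribution_axioms real_distribution_pareto[OF pos]])
    fix x assume x: "isCont (cdf ?\<mu>) x"
    consider "x \<le> 0" | "0 < x" "x \<le> 1" | "x > 1" by linarith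
    then show "cdf ?\<mu> x = cdf (pareto \<gamma>) x"
    proof cases
      case 1
      then show ?thesis using nonpos pos by (simp add: cdf_pareto pareto_cdf_def)
    next
      case 2
      then show ?thesis
        using cdf_eq[OF scaled_exponent_tendsto_zero[OF L] _ x] pos by (auto simp: cdf_pareto pareto_cdf_def)
    next
      case 3
      then show ?thesis
        using cdf_eq[OF scaled_exponent_tendsto[OF \<gamma>] _ x] pos
        by (auto simp: cdf_pareto pareto_cdf_def powr_def)
    qed
  qed
qed

text \<open>The identity on the Pareto law itself is the witness that leads from S3 back to the
  existence of a nondegenerate positive limit variable.\<close>

lemma nondegenerate_positive_rv_pareto:
  assumes \<gamma>: "\<gamma> > 0"
  shows "nondegenerate_positive_rv (pareto \<gamma>) (\<lambda>x. x)" and "distr (pareto \<gamma>) borel (\<lambda>x. x) = pareto \<gamma>"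
proof -
  interpret P: real_distribution "pareto \<gamma>" by (rule real_distribution_pareto[OF \<gamma>])
  show "distr (pareto \<gamma>) borel (\<lambda>x. x) = pareto \<gamma>"
    using distr_id2[of borel "pareto \<gamma>"] by simp
  have "P.prob {..0} = 0" using cdf_pareto[OF \<gamma>] by (simp add: cdf_def fun_eq_iff pareto_cdf_def)
  then have "AE x in pareto \<gamma>. x \<notin> {..0}" by (subst (asm) P.prob_eq_0) auto
  then have "AE x in pareto \<gamma>. 0 < x" by (rule eventually_mono) auto
  moreover have False if c: "AE x in pareto \<gamma>. x = c" for c
  proof -
    \<comment> \<open>A constant variable has a distribution function with values 0 and 1 only,
      whereas at 2 the Pareto one is strictly between them.\<close>
    have "cdf (pareto \<gamma>) x \<in> {0, 1}" for x
    proof -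
      have "P.prob {..x} = P.prob (if c \<le> x then UNIV else {})"
        using c by (intro P.finite_measure_eq_AE) (auto elim!: eventually_mono)
      then show ?thesis using P.prob_space by (auto simp: cdf_def split: if_splits)
    qed
    from this[of 2] show False using \<gamma> by (auto simp: cdf_pareto pareto_cdf_def)
  qed
  ultimately show "nondegenerate_positive_rv (pareto \<gamma>) (\<lambda>x. x)"
    unfolding nondegenerate_positive_rv_def using P.prob_space_axioms by auto
qed

section \<open>Distribution functions and densities near the origin\<close>

text \<open>Increments are expressed over open intervals so that the endpoint 0, where neither the
  asymptotics nor the monotonicity of \<open>f\<close> says anything, stays out of later pointwise
  comparisons.\<close>

lemma density_near_origin_increment:
  assumes "density_near_origin F f"
  obtains \<delta> where "\<delta> > 0" "F 0 = 0"
    "\<And>a b. 0 \<le> a \<Longrightarrow> a \<le> b \<Longrightarrow> b < \<delta> \<Longrightarrow> (f has_integral (F b - F a)) {a<..<b}"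
proof -
  obtain \<delta> where \<delta>: "\<delta> > 0" "\<And>x. 0 \<le> x \<Longrightarrow> x < \<delta> \<Longrightarrow> set_integrable lebesgue {0..x} f"
    "\<And>x. 0 \<le> x \<Longrightarrow> x < \<delta> \<Longrightarrow> F x = (LINT u:{0..x}|lebesgue. f u)"
    using assms unfolding density_near_origin_def by blast
  have int: "f integrable_on {0..x}" and F: "F x = integral {0..x} f" if "0 \<le> x" "x < \<delta>" for x
    using set_lebesgue_integral_eq_integral[OF \<delta>(2)[OF that]] \<delta>(3)[OF that] by auto
  have "F 0 = 0" using F[of 0] \<delta>(1) by simp
  moreover have "(f has_integral (F b - F a)) {a<..<b}" if "0 \<le> a" "a \<le> b" "b < \<delta>" for a b
  proof -
    have b: "f integrable_on {0..b}" using int that by simp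
    then have "f integrable_on {a..b}" using that by (auto intro: integrable_subinterval_real)
    moreover have "integral {a..b} f = F b - F a"
      using Henstock_Kurzweil_Integration.integral_combine[OF that(1,2) b] F[of a] F[of b] that by simp
    ultimately show ?thesis by (metis has_integral_Icc_iff_Ioo has_integral_iff)
  qed
  ultimately show thesis using that \<delta>(1) by blast
qed

lemma has_integral_Ioo_le_const:
  fixes f :: "real \<Rightarrow> real"
  assumes "(f has_integral I) {a<..<b}" "a \<le> b" "\<And>u. a < u \<Longrightarrow> u < b \<Longrightarrow> f u \<le> c"
  shows "I \<le> c * (b - a)"
proof (rule has_integral_le[OF assms(1)])
  show "((\<lambda>_. c) has_integral c * (b - a)) {a<..<b}"
    using has_integral_const_real[of c a b] assms(2)
    by (simp add: has_integral_Icc_iff_Ioo[symmetric] mult.commute)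
qed (use assms(3) in auto)

lemma has_integral_Ioo_ge_const:
  fixes f :: "real \<Rightarrow> real"
  assumes "(f has_integral I) {a<..<b}" "a \<le> b" "\<And>u. a < u \<Longrightarrow> u < b \<Longrightarrow> c \<le> f u"
  shows "c * (b - a) \<le> I"
  using has_integral_Ioo_le_const[OF has_integral_neg[OF assms(1)] assms(2), of "- c"] assms(3) by auto

text \<open>For \<open>c < \<gamma>\<close> the density is eventually at most
  \<open>x powr (c - 1)\<close>, for \<open>c > \<gamma>\<close> at least that. Integration gives
  \<open>x powr c / c\<close>, whose divisor is invisible after division by \<open>ln x\<close>, and
  \<open>c\<close> may be taken arbitrarily close to \<gamma>. Positivity of \<gamma> allows
  \<open>c > 0\<close> also from below, which makes the power integrable at 0.\<close>

lemma log_ratio_distribution_of_density: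
  assumes dens: "density_near_origin F f" and \<gamma>: "\<gamma> > 0" and f: "log_ratio_at_origin f (\<gamma> - 1)"
  shows "log_ratio_at_origin F \<gamma>"
proof -
  obtain \<delta> where \<delta>: "\<delta> > 0" "F 0 = 0"
    "\<And>a b. 0 \<le> a \<Longrightarrow> a \<le> b \<Longrightarrow> b < \<delta> \<Longrightarrow> (f has_integral (F b - F a)) {a<..<b}"
    by (rule density_near_origin_increment[OF dens]) (rule that, assumption+)
  have f_pos: "\<forall>\<^sub>F x in at_right 0. f x > 0"
    and f_lim: "((\<lambda>x. ln (f x) / ln x) \<longlongrightarrow> \<gamma> - 1) (at_right 0)"
    using f by (auto simp: log_ratio_at_origin_def)
  have x01: "\<forall>\<^sub>F x :: real in at_right 0. 0 < x \<and> x < 1"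
    by (auto simp: eventually_at_right_field intro!: exI[of _ 1])
  have powr_int: "((\<lambda>x. x powr (c - 1)) has_integral (x powr c / c)) {0<..<x}" if "c > 0" "x > 0" for c x :: real
    using has_integral_powr_from_0[of "c - 1" x] that by (simp add: has_integral_Icc_iff_Ioo)
  have upper: "\<forall>\<^sub>F x in at_right 0. F x \<le> x powr c / c" if c: "0 < c" "c < \<gamma>" for c
  proof -
    have "\<forall>\<^sub>F x in at_right 0. c - 1 < ln (f x) / ln x"
      using f_lim c by (intro order_tendstoD) auto
    with f_pos x01 have "\<forall>\<^sub>F x in at_right 0. f x \<le> x powr (c - 1)"
    proof eventually_elim
      case (elim x)
      then have "ln (f x) \<le> (c - 1) * ln x" by (simp add: less_divide_eq split: if_splits)
      then have "ln (f x) \<le> ln (x powr (c - 1))" using elim by (simp add: ln_powr)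
      then show ?case using elim by (subst (asm) ln_le_cancel_iff) auto
    qed
    then obtain d where d: "d > 0" "\<And>x. 0 < x \<Longrightarrow> x < d \<Longrightarrow> f x \<le> x powr (c - 1)"
      by (auto simp: eventually_at_right_field)
    have "F x \<le> x powr c / c" if x: "0 < x" "x < min d \<delta>" for x
      using has_integral_le[OF \<delta>(3)[of 0 x] powr_int[OF c(1) x(1)]] d(2) x \<delta>(2) by auto
    then show ?thesis
      using d(1) \<delta>(1) by (auto simp: eventually_at_right_field intro!: exI[of _ "min d \<delta>"])
  qed
  have lower: "\<forall>\<^sub>F x in at_right 0. x powr c / c \<le> F x" if c: "\<gamma> < c" for c
  proof -
    have "\<forall>\<^sub>F x in at_right 0. ln (f x) / ln x < c - 1"
      using f_lim c by (intro order_tendstoD) auto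
    with f_pos x01 have "\<forall>\<^sub>F x in at_right 0. x powr (c - 1) \<le> f x"
    proof eventually_elim
      case (elim x)
      then have "(c - 1) * ln x \<le> ln (f x)" by (simp add: divide_less_eq split: if_splits)
      then have "ln (x powr (c - 1)) \<le> ln (f x)" using elim by (simp add: ln_powr)
      then show ?case using elim by (subst (asm) ln_le_cancel_iff) auto
    qed
    then obtain d where d: "d > 0" "\<And>x. 0 < x \<Longrightarrow> x < d \<Longrightarrow> x powr (c - 1) \<le> f x"
      by (auto simp: eventually_at_right_field)
    have "x powr c / c \<le> F x" if x: "0 < x" "x < min d \<delta>" for x
      using has_integral_le[OF powr_int[of c x] \<delta>(3)[of 0 x]] d(2) x \<delta>(2) c \<gamma> by auto
    then show ?thesis
      using d(1) \<delta>(1) by (auto simp: eventually_at_right_field intro!: exI[of _ "min d \<delta>"])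
  qed
  have F_pos: "\<forall>\<^sub>F x in at_right 0. F x > 0"
    using lower[OF less_add_one] x01
  proof eventually_elim
    case (elim x)
    have "x powr (\<gamma> + 1) / (\<gamma> + 1) > 0" using elim \<gamma> by simp
    with elim show ?case by simp
  qed
  have ln_powr_div: "ln (x powr c / c) = c * ln x - ln c" if "x > 0" "c > 0" for x c :: real
    using that by (simp add: ln_div ln_powr)
  have ratio_lim: "((\<lambda>x. c - ln c / ln x) \<longlongrightarrow> c - 0) (at_right 0)" for c :: real
    by (intro tendsto_diff tendsto_const) real_asymp
  have "((\<lambda>x. ln (F x) / ln x) \<longlongrightarrow> \<gamma>) (at_right 0)"
  proof (rule order_tendstoI)
    fix a assume "a < \<gamma>"
    then obtain c where c: "max a 0 < c" "c < \<gamma>" using \<gamma> dense[of "max a 0" \<gamma>] by auto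
    then have c_pos: "c > 0" by simp
    have "\<forall>\<^sub>F x in at_right 0. a < c - ln c / ln x"
      using ratio_lim by (rule order_tendstoD) (use c in simp)
    then show "\<forall>\<^sub>F x in at_right 0. a < ln (F x) / ln x"
      using upper[OF c_pos c(2)] F_pos x01
    proof eventually_elim
      case (elim x)
      then have "ln (F x) \<le> ln (x powr c / c)" using c_pos by (subst ln_le_cancel_iff) auto
      then have "ln (F x) \<le> c * ln x - ln c" using elim c_pos by (simp add: ln_powr_div)
      then have "(c * ln x - ln c) / ln x \<le> ln (F x) / ln x"
        using elim by (intro divide_right_mono_neg) auto
      then show ?case using elim by (simp add: diff_divide_distrib)
    qed
  next
    fix a assume "\<gamma> < a"
    then obtain c where c: "\<gamma> < c" "c < a" using dense by blast
    have "\<forall>\<^sub>F x in at_right 0. c - ln c / ln x < a"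
      using ratio_lim by (rule order_tendstoD) (use c in simp)
    then show "\<forall>\<^sub>F x in at_right 0. ln (F x) / ln x < a"
      using lower[OF c(1)] F_pos x01
    proof eventually_elim
      case (elim x)
      then have "ln (x powr c / c) \<le> ln (F x)" using c \<gamma> by (subst ln_le_cancel_iff) auto
      then have "c * ln x - ln c \<le> ln (F x)" using elim c \<gamma> by (simp add: ln_powr_div)
      then have "ln (F x) / ln x \<le> (c * ln x - ln c) / ln x"
        using elim by (intro divide_right_mono_neg) auto
      then show ?case using elim by (simp add: diff_divide_distrib)
    qed
  qed
  with F_pos show ?thesis by (simp add: log_ratio_at_origin_def)
qed

text \<open>An increasing density is at most \<open>f x\<close> to the left of \<open>x\<close> and
  at least \<open>f x\<close> to the right, so \<open>f x * x\<close> lies between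
  \<open>F x\<close> and \<open>F (2 * x)\<close>. The factor 2 is invisible on the logarithmic
  scale.\<close>

lemma log_ratio_density_of_distribution_mono:
  assumes dens: "density_near_origin F f" and F: "log_ratio_at_origin F \<gamma>"
    and d: "d > 0" and mono: "mono_on {0<..<d} f"
  shows "log_ratio_at_origin f (\<gamma> - 1)"
proof -
  obtain \<delta> where \<delta>: "\<delta> > 0" "F 0 = 0"
    "\<And>a b. 0 \<le> a \<Longrightarrow> a \<le> b \<Longrightarrow> b < \<delta> \<Longrightarrow> (f has_integral (F b - F a)) {a<..<b}"
    by (rule density_near_origin_increment[OF dens]) (rule that, assumption+)
  have F_pos: "\<forall>\<^sub>F x in at_right 0. F x > 0"
    and F_lim: "((\<lambda>x. ln (F x) / ln x) \<longlongrightarrow> \<gamma>) (at_right 0)"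
    using F by (auto simp: log_ratio_at_origin_def)
  have double: "filterlim (\<lambda>x::real. 2 * x) (at_right 0) (at_right 0)" by real_asymp
  have F_pos2: "\<forall>\<^sub>F x in at_right 0. F (2 * x) > 0"
    using eventually_compose_filterlim[OF F_pos double] .
  have small: "\<forall>\<^sub>F x in at_right 0. 0 < x \<and> 2 * x < 1 \<and> 2 * x < d \<and> 2 * x < \<delta>"
    using d \<delta>(1) by (auto simp: eventually_at_right_field intro!: exI[of _ "min (1/2) (min (d/2) (\<delta>/2))"])
  have bounds: "\<forall>\<^sub>F x in at_right 0. F x \<le> f x * x \<and> f x * x \<le> F (2 * x)"
    using small F_pos
  proof eventually_elim
    case (elim x)
    have "F x - F 0 \<le> f x * (x - 0)"
      using elim by (intro has_integral_Ioo_le_const[OF \<delta>(3)]) (auto intro!: mono_onD[OF mono])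
    moreover have "f x * (2 * x - x) \<le> F (2 * x) - F x"
      using elim by (intro has_integral_Ioo_ge_const[OF \<delta>(3)]) (auto intro!: mono_onD[OF mono])
    ultimately show ?case using elim \<delta>(2) by auto
  qed
  have f_pos: "\<forall>\<^sub>F x in at_right 0. f x > 0"
    using bounds F_pos small
  proof eventually_elim
    case (elim x)
    then have "0 < f x * x" by linarith
    then show ?case using elim by (simp add: zero_less_mult_iff)
  qed
  have "((\<lambda>x. ln (f x) / ln x) \<longlongrightarrow> \<gamma> - 1) (at_right 0)"
  proof (rule tendsto_sandwich)
    show "\<forall>\<^sub>F x in at_right 0. ln (F (2 * x)) / ln x - 1 \<le> ln (f x) / ln x"
      using bounds F_pos2 f_pos small
    proof eventually_elim
      case (elim x)
      then have "ln (f x * x) \<le> ln (F (2 * x))" by (subst ln_le_cancel_iff) auto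
      then have "ln (f x) \<le> ln (F (2 * x)) - ln x" using elim by (simp add: ln_mult)
      then have "(ln (F (2 * x)) - ln x) / ln x \<le> ln (f x) / ln x"
        using elim by (intro divide_right_mono_neg) auto
      then show ?case using elim by (simp add: diff_divide_distrib)
    qed
    show "\<forall>\<^sub>F x in at_right 0. ln (f x) / ln x \<le> ln (F x) / ln x - 1"
      using bounds F_pos f_pos small
    proof eventually_elim
      case (elim x)
      then have "ln (F x) \<le> ln (f x * x)" by (subst ln_le_cancel_iff) auto
      then have "ln (F x) - ln x \<le> ln (f x)" using elim by (simp add: ln_mult)
      then have "ln (f x) / ln x \<le> (ln (F x) - ln x) / ln x"
        using elim by (intro divide_right_mono_neg) auto
      then show ?case using elim by (simp add: diff_divide_distrib)
    qed
    have "((\<lambda>x. ln (F (2 * x)) / ln (2 * x) * (ln (2 * x) / ln x) - 1) \<longlongrightarrow> \<gamma> * 1 - 1) (at_right 0)"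
      by (intro tendsto_diff tendsto_mult tendsto_const filterlim_compose[OF F_lim double]) real_asymp
    moreover have "\<forall>\<^sub>F x in at_right 0. ln (F (2 * x)) / ln (2 * x) * (ln (2 * x) / ln x) - 1
        = ln (F (2 * x)) / ln x - 1"
      using small
    proof eventually_elim
      case (elim x)
      then have "ln (2 * x) < 0" by simp
      then show ?case by simp
    qed
    ultimately have "((\<lambda>x. ln (F (2 * x)) / ln x - 1) \<longlongrightarrow> \<gamma> * 1 - 1) (at_right 0)"
      by (rule Lim_transform_eventually)
    then show "((\<lambda>x. ln (F (2 * x)) / ln x - 1) \<longlongrightarrow> \<gamma> - 1) (at_right 0)" by simp
    show "((\<lambda>x. ln (F x) / ln x - 1) \<longlongrightarrow> \<gamma> - 1) (at_right 0)"
      by (intro tendsto_diff F_lim tendsto_const)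
  qed
  with f_pos show ?thesis by (simp add: log_ratio_at_origin_def)
qed

text \<open>For decreasing \<open>f\<close> an increment over \<open>[x, c x]\<close> with constant \<open>c\<close> may vanish on the logarithmic
  scale; increments over \<open>[x, x powr k]\<close> with \<open>k < 1\<close> do not, at the price of an error that
  disappears as \<open>k \<rightarrow> 1\<close>.\<close>

lemma log_ratio_density_of_distribution_antimono:
  assumes dens: "density_near_origin F f" and F: "log_ratio_at_origin F \<gamma>" and \<gamma>: "\<gamma> > 0"
    and d: "d > 0" and mono: "antimono_on {0<..<d} f"
  shows "log_ratio_at_origin f (\<gamma> - 1)"
proof -
  obtain \<delta> where \<delta>: "\<delta> > 0" "F 0 = 0"
    "\<And>a b. 0 \<le> a \<Longrightarrow> a \<le> b \<Longrightarrow> b < \<delta> \<Longrightarrow> (f has_integral (F b - F a)) {a<..<b}"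
    by (rule density_near_origin_increment[OF dens]) (rule that, assumption+)
  have F_pos: "\<forall>\<^sub>F x in at_right 0. F x > 0"
    and F_lim: "((\<lambda>x. ln (F x) / ln x) \<longlongrightarrow> \<gamma>) (at_right 0)"
    using F by (auto simp: log_ratio_at_origin_def)
  have antimono: "f v \<le> f u" if "0 < u" "u \<le> v" "v < d" for u v
    using monotone_onD[OF mono, of u v] that by simp
  have powr_0: "filterlim (\<lambda>x::real. x powr k) (at_right 0) (at_right 0)" if "k > 0" for k :: real
    using that by real_asymp
  have small: "\<forall>\<^sub>F x in at_right 0. 0 < x \<and> x < 1 \<and> x < d \<and> x < \<delta>"
    using d \<delta>(1) by (auto simp: eventually_at_right_field intro!: exI[of _ "min 1 (min d \<delta>)"])
  have lower: "\<forall>\<^sub>F x in at_right 0. F (x powr k) / 2 \<le> f x * x powr k \<and> F (x powr k) > 0"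
    and F_powr: "((\<lambda>x. ln (F (x powr k)) / ln x) \<longlongrightarrow> \<gamma> * k) (at_right 0)"
    if k: "0 < k" "k < 1" for k
  proof -
    note powr_k = powr_0[OF k(1)]
    have "((\<lambda>x. ln (F (x powr k)) / ln (x powr k) * k) \<longlongrightarrow> \<gamma> * k) (at_right 0)"
      by (intro tendsto_mult tendsto_const filterlim_compose[OF F_lim powr_k])
    moreover have "\<forall>\<^sub>F x in at_right 0. ln (F (x powr k)) / ln (x powr k) * k = ln (F (x powr k)) / ln x"
      using small by eventually_elim (use k in \<open>simp add: ln_powr\<close>)
    ultimately show F_powr: "((\<lambda>x. ln (F (x powr k)) / ln x) \<longlongrightarrow> \<gamma> * k) (at_right 0)"
      by (rule Lim_transform_eventually)
    \<comment> \<open>On the logarithmic scale \<open>F x\<close> has exponent \<gamma> and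
      \<open>F (x powr k)\<close> the smaller exponent \<open>\<gamma> * k\<close>. The positive
      gap, which needs \<open>\<gamma> > 0\<close>, makes \<open>F x\<close> less than half of
      \<open>F (x powr k)\<close>; so at least half of the latter is an increment beyond
      \<open>x\<close>, where \<open>f\<close> is at most \<open>f x\<close>.\<close>
    have "((\<lambda>x. ln (F x) / ln x - ln (F (x powr k)) / ln x + ln 2 / ln x) \<longlongrightarrow> \<gamma> - \<gamma> * k + 0) (at_right 0)"
      by (intro tendsto_add tendsto_diff F_lim F_powr) real_asymp
    moreover have "\<gamma> - \<gamma> * k + 0 > 0" using \<gamma> k by simp
    ultimately have "\<forall>\<^sub>F x in at_right 0. ln (F x) / ln x - ln (F (x powr k)) / ln x + ln 2 / ln x > 0"
      by (rule order_tendstoD)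
    then show "\<forall>\<^sub>F x in at_right 0. F (x powr k) / 2 \<le> f x * x powr k \<and> F (x powr k) > 0"
      using F_pos eventually_compose_filterlim[OF F_pos powr_k] small eventually_compose_filterlim[OF small powr_k]
    proof eventually_elim
      case (elim x)
      let ?z = "x powr k"
      have x_less: "x < ?z" using powr_less_mono'[of x k 1] elim k by simp
      have "ln (F x) / ln x - ln (F ?z) / ln x + ln 2 / ln x = (ln (F x) + ln 2 - ln (F ?z)) / ln x"
        by (simp add: add_divide_distrib diff_divide_distrib)
      then have "ln (F x) + ln 2 - ln (F ?z) < 0"
        using elim by (simp add: zero_less_divide_iff)
      then have "ln (2 * F x) < ln (F ?z)" using elim by (simp add: ln_mult)
      then have "2 * F x < F ?z" using elim by (subst (asm) ln_less_cancel_iff) auto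
      moreover have "F ?z - F x \<le> f x * (?z - x)"
        using elim x_less by (intro has_integral_Ioo_le_const[OF \<delta>(3)] antimono) auto
      ultimately have *: "F ?z / 2 \<le> f x * (?z - x)" by simp
      have "f x > 0"
      proof (rule ccontr)
        assume "\<not> f x > 0"
        then have "f x * (?z - x) \<le> 0" using x_less by (intro mult_nonpos_nonneg) auto
        with * elim show False by simp
      qed
      then have "f x * (?z - x) \<le> f x * ?z" using elim by (intro mult_left_mono) auto
      with * elim show ?case by simp
    qed
  qed
  have upper: "\<forall>\<^sub>F x in at_right 0. f x * x \<le> F x"
    using small
  proof eventually_elim
    case (elim x)
    have "f x * (x - 0) \<le> F x - F 0"
      using elim by (intro has_integral_Ioo_ge_const[OF \<delta>(3)] antimono) auto
    then show ?case using \<delta>(2) by simp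
  qed
  have f_pos: "\<forall>\<^sub>F x in at_right 0. f x > 0"
    using lower[of "1/2", simplified] small
  proof eventually_elim
    case (elim x)
    then have "0 < f x * x powr (1/2)" by linarith
    then show ?case using elim by (simp add: zero_less_mult_iff)
  qed
  have "((\<lambda>x. ln (f x) / ln x) \<longlongrightarrow> \<gamma> - 1) (at_right 0)"
  proof (rule order_tendstoI)
    fix a assume a: "a < \<gamma> - 1"
    have "((\<lambda>x. ln (F x) / ln x - 1) \<longlongrightarrow> \<gamma> - 1) (at_right 0)"
      by (intro tendsto_diff F_lim tendsto_const)
    then have "\<forall>\<^sub>F x in at_right 0. a < ln (F x) / ln x - 1" using a by (rule order_tendstoD)
    then show "\<forall>\<^sub>F x in at_right 0. a < ln (f x) / ln x"
      using upper F_pos f_pos small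
    proof eventually_elim
      case (elim x)
      then have "ln (f x * x) \<le> ln (F x)" by (subst ln_le_cancel_iff) auto
      then have "ln (f x) \<le> ln (F x) - ln x" using elim by (simp add: ln_mult)
      then have "(ln (F x) - ln x) / ln x \<le> ln (f x) / ln x"
        using elim by (intro divide_right_mono_neg) auto
      then show ?case using elim by (simp add: diff_divide_distrib)
    qed
  next
    fix a assume a: "\<gamma> - 1 < a"
    \<comment> \<open>For fixed \<open>k\<close> the lower bound on \<open>f\<close> yields the
      exponent \<open>\<gamma> * k - k\<close>; \<open>k\<close> close enough to 1 brings it below
      \<open>a\<close>.\<close>
    have "((\<lambda>k. (\<gamma> - 1) * k) \<longlongrightarrow> (\<gamma> - 1) * 1) (at_left 1)"
      by (intro tendsto_intros)
    then have "\<forall>\<^sub>F k in at_left 1. (\<gamma> - 1) * k < a" using a by (intro order_tendstoD) auto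
    moreover have "\<forall>\<^sub>F k :: real in at_left 1. 0 < k \<and> k < 1"
      by (auto simp: eventually_at_left_field intro!: exI[of _ 0])
    ultimately obtain k where k: "(\<gamma> - 1) * k < a" "0 < k" "k < 1"
      using eventually_happens'[OF trivial_limit_at_left_real eventually_conj] by blast
    have "((\<lambda>x. ln (F (x powr k)) / ln x - ln 2 / ln x - k) \<longlongrightarrow> \<gamma> * k - 0 - k) (at_right 0)"
      by (intro tendsto_diff F_powr[OF k(2,3)] tendsto_const) real_asymp
    moreover have "\<gamma> * k - 0 - k < a" using k(1) by (simp add: algebra_simps)
    ultimately have "\<forall>\<^sub>F x in at_right 0. ln (F (x powr k)) / ln x - ln 2 / ln x - k < a"
      by (rule order_tendstoD)
    then show "\<forall>\<^sub>F x in at_right 0. ln (f x) / ln x < a"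
      using lower[OF k(2,3)] f_pos small
    proof eventually_elim
      case (elim x)
      then have "ln (F (x powr k) / 2) \<le> ln (f x * x powr k)" by (subst ln_le_cancel_iff) auto
      then have "ln (F (x powr k)) - ln 2 - k * ln x \<le> ln (f x)"
        using elim by (simp add: ln_mult ln_div ln_powr)
      then have "ln (f x) / ln x \<le> (ln (F (x powr k)) - ln 2 - k * ln x) / ln x"
        using elim by (intro divide_right_mono_neg) auto
      then show ?case using elim by (simp add: diff_divide_distrib)
    qed
  qed
  with f_pos show ?thesis by (simp add: log_ratio_at_origin_def)
qed

theorem theorem3p1:
  fixes M :: "'a measure" and Y :: "real \<Rightarrow> 'a \<Rightarrow> real" and \<nu> :: "real measure"
    and F :: "real \<Rightarrow> real"
  assumes sub: "driftless_subordinator M Y \<nu>"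
    and pos: "\<And>t. t > 0 \<Longrightarrow> AE \<omega> in M. 0 < Y t \<omega>"
    and F: "F = cdf (distr M borel (Y 1))"
  shows
    "(\<forall>(N :: 'b measure) Ystar. nondegenerate_positive_rv N Ystar \<longrightarrow>
       (let
          S1 = weak_conv_filter (power_law M Y) (distr N borel Ystar) (at_right 0);
          S2 = scaled_exponent_converges \<nu> (cdf (distr N borel Ystar));
          S3 = (\<exists>\<gamma>>0. weak_conv_filter (power_law M Y) (pareto \<gamma>) (at_right 0) \<and>
                      distr N borel Ystar = pareto \<gamma>)
        in (S1 \<longleftrightarrow> S2) \<and> (S2 \<longleftrightarrow> S3))) \<and>
    (let
       S1 = (\<exists>(N :: real measure) Ystar. nondegenerate_positive_rv N Ystar \<and>
               weak_conv_filter (power_law M Y) (distr N borel Ystar) (at_right 0));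
       S2 = (\<exists>(N :: real measure) Ystar. nondegenerate_positive_rv N Ystar \<and>
               scaled_exponent_converges \<nu> (cdf (distr N borel Ystar)));
       S3 = (\<exists>\<gamma>>0. weak_conv_filter (power_law M Y) (pareto \<gamma>) (at_right 0))
     in (S1 \<longleftrightarrow> S2) \<and> (S2 \<longleftrightarrow> S3)) \<and>
    (\<forall>\<gamma>>0.
       let
         S4 = weak_conv_filter (power_law M Y) (pareto \<gamma>) (at_right 0);
         S5 = ((\<lambda>s. laplace_exponent \<nu> s / ln s) \<longlongrightarrow> \<gamma>) at_top;
         S6 = log_ratio_at_origin F \<gamma>;
         S7 = ((\<lambda>x. levy_tail \<nu> x / ln x) \<longlongrightarrow> - \<gamma>) (at_right 0)
       in (S4 \<longleftrightarrow> S5) \<and> (S5 \<longleftrightarrow> S6) \<and> (S6 \<longleftrightarrow> S7) \<and>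
          (\<forall>f. density_near_origin F f \<longrightarrow>
             (let S8 = log_ratio_at_origin f (\<gamma> - 1)
              in (S8 \<longrightarrow> S4 \<and> S5 \<and> S6 \<and> S7) \<and>
                 (monotone_near_origin f \<longrightarrow>
                    (S8 \<longleftrightarrow> S4) \<and> (S8 \<longleftrightarrow> S5) \<and> (S8 \<longleftrightarrow> S6) \<and> (S8 \<longleftrightarrow> S7)))))"
proof -
  interpret driftless_subordinator M Y \<nu> by (rule sub)
  let ?lim = "\<lambda>\<gamma>. ((\<lambda>s. laplace_exponent \<nu> s / ln s) \<longlongrightarrow> \<gamma>) at_top"
  let ?W = "\<lambda>\<mu>. weak_conv_filter (power_law M Y) \<mu> (at_right 0)"
  \<comment> \<open>The type \<open>'c\<close> is left general because the equivalence is applied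
    both to variables over \<open>'b\<close> and, in the existential form, to variables over the
    reals.\<close>
  have S1_iff_S2: "?W (distr N borel Z) \<longleftrightarrow> scaled_exponent_converges \<nu> (cdf (distr N borel Z))"
    if "nondegenerate_positive_rv N Z" for N :: "'c measure" and Z
    by (rule weak_conv_power_law_iff[OF sub pos nondegenerate_positive_rv_distr[OF that]])
  have S4_iff_S5: "?W (pareto \<gamma>) \<longleftrightarrow> ?lim \<gamma>" if \<gamma>: "\<gamma> > 0" for \<gamma>
  proof -
    have "?W (pareto \<gamma>) \<longleftrightarrow> scaled_exponent_converges \<nu> (cdf (pareto \<gamma>))"
      using \<gamma> by (intro weak_conv_power_law_iff[OF sub pos real_distribution_pareto])
        (auto simp: cdf_pareto pareto_cdf_def)
    then show ?thesis using scaled_exponent_converges_pareto_iff[OF levy_measure \<gamma>] by simp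
  qed
  have S2_imp_S3: "\<exists>\<gamma>>0. ?W (pareto \<gamma>) \<and> distr N borel Z = pareto \<gamma>"
    if "nondegenerate_positive_rv N Z" "scaled_exponent_converges \<nu> (cdf (distr N borel Z))"
    for N :: "'c measure" and Z
    using scaled_exponent_limit_is_pareto[OF levy_measure that] S4_iff_S5 by metis
  have Y1: "random_variable borel (Y 1)" using random_variable_Y by simp
  have F_eq: "F x = prob {\<omega> \<in> space M. Y 1 \<omega> \<le> x}" for x
    by (auto simp: F cdf_def measure_distr Y1 vimage_def Int_def conj_commute)
  have laplace: "exp (- laplace_exponent \<nu> s) = expectation (\<lambda>\<omega>. exp (- s * Y 1 \<omega>))" if "s > 0" for s
    using laplace_transform[of 1 s] that by simp
  have S5_iff_S6: "?lim \<gamma> \<longleftrightarrow> log_ratio_at_origin F \<gamma>" for \<gamma>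
  proof (rule exponent_log_growth_iff_log_ratio)
    fix s x :: real assume "s > 0"
    then show "F x * exp (- s * x) \<le> exp (- laplace_exponent \<nu> s)"
      using laplace_ge_prob_le[OF Y1 pos, of s x] by (simp only: laplace F_eq)
    show "exp (- laplace_exponent \<nu> s) \<le> F x + exp (- s * x)"
      using laplace_le_prob_less[OF Y1 pos, of s x] prob_less_le_prob_le[OF Y1, of x] \<open>s > 0\<close>
      by (simp add: laplace F_eq)
  qed
  have S8_imp_S6: "log_ratio_at_origin f (\<gamma> - 1) \<Longrightarrow> log_ratio_at_origin F \<gamma>"
    if "density_near_origin F f" "\<gamma> > 0" for f \<gamma>
    by (rule log_ratio_distribution_of_density[OF that])
  have S6_imp_S8: "log_ratio_at_origin F \<gamma> \<Longrightarrow> log_ratio_at_origin f (\<gamma> - 1)"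
    if "density_near_origin F f" "\<gamma> > 0" "monotone_near_origin f" for f \<gamma>
    using that log_ratio_density_of_distribution_mono log_ratio_density_of_distribution_antimono
    unfolding monotone_near_origin_def by blast
  \<comment> \<open>The way back from S3 is immediate: there the law of \<open>Z\<close> is the
    Pareto law, so S3 contains S1 and hence S2.\<close>
  have "?W (distr N borel Z) \<longleftrightarrow> scaled_exponent_converges \<nu> (cdf (distr N borel Z))"
    "scaled_exponent_converges \<nu> (cdf (distr N borel Z)) \<longleftrightarrow>
      (\<exists>\<gamma>>0. ?W (pareto \<gamma>) \<and> distr N borel Z = pareto \<gamma>)"
    if "nondegenerate_positive_rv N Z" for N :: "'b measure" and Z
    using S1_iff_S2[OF that] S2_imp_S3[OF that] by auto
  moreover have "(\<exists>(N :: real measure) Z. nondegenerate_positive_rv N Z \<and> ?W (distr N borel Z)) \<longleftrightarrow>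
      (\<exists>(N :: real measure) Z. nondegenerate_positive_rv N Z \<and>
        scaled_exponent_converges \<nu> (cdf (distr N borel Z)))"
    using S1_iff_S2 by blast
  moreover have "(\<exists>(N :: real measure) Z. nondegenerate_positive_rv N Z \<and>
        scaled_exponent_converges \<nu> (cdf (distr N borel Z))) \<longleftrightarrow> (\<exists>\<gamma>>0. ?W (pareto \<gamma>))"
  proof
    assume "\<exists>\<gamma>>0. ?W (pareto \<gamma>)"
    then obtain \<gamma> where "\<gamma> > 0" "?W (pareto \<gamma>)" by blast
    then show "\<exists>(N :: real measure) Z. nondegenerate_positive_rv N Z \<and>
        scaled_exponent_converges \<nu> (cdf (distr N borel Z))"
      using nondegenerate_positive_rv_pareto[of \<gamma>] S1_iff_S2[of "pareto \<gamma>" "\<lambda>x. x"]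
      by (intro exI[of _ "pareto \<gamma>"] exI[of _ "\<lambda>x. x"]) auto
  qed (use S2_imp_S3 in blast)
  moreover have "(?W (pareto \<gamma>) \<longleftrightarrow> ?lim \<gamma>) \<and> (?lim \<gamma> \<longleftrightarrow> log_ratio_at_origin F \<gamma>) \<and>
      (log_ratio_at_origin F \<gamma> \<longleftrightarrow> ((\<lambda>x. levy_tail \<nu> x / ln x) \<longlongrightarrow> - \<gamma>) (at_right 0))"
    if "\<gamma> > 0" for \<gamma>
    using S4_iff_S5[OF that] S5_iff_S6[of \<gamma>] exponent_log_growth_iff_levy_tail[OF levy_measure that]
    by simp
  ultimately show ?thesis
    unfolding Let_def using S8_imp_S6 S6_imp_S8 by meson
qed

end
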